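(* Every infinite indexed language $L$ has an infinite subset which is a CD0L language.
   Context: Indexed languages are the languages generated by indexed grammars (Aho's grammars in which nonterminals carry stacks that can be pushed, popped and copied). A morphism on an alphabet $A$ is a map $h:A^*\to A^*$ with $h(xy)=h(x)h(y)$; it is a coding if $|h(a)|=1$ for all $a\in A$. A CD0L system is a tuple $(A,h,w,g)$ with $A$ an alphabet, $h$ a morphism on $A$, $g$ a coding on $A$, and $w\in A^*$; its language is $\{g(h^i(w)):i\ge0\}$. A CD0L language is the language of some CD0L system. *)

theory Defs
  imports Main
begin

datatype ('n, 't) gsym = Ter 't | NTer 'n

text \<open>Productions of an indexed grammar (standard form, equivalent to Aho's):
  Copy A alpha : A[sigma] -> alpha[sigma]   (stack copied to every nonterminal of alpha)
  Push A B f   : A[sigma] -> B[f sigma]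
  Pop A f alpha: A[f sigma] -> alpha[sigma]\<close>
datatype ('n, 't, 'f) iprod =
    Copy 'n "('n, 't) gsym list"
  | Push 'n 'n 'f
  | Pop 'n 'f "('n, 't) gsym list"

text \<open>Items of sentential forms: terminals, or nonterminals carrying an index stack
  (head of the list = top of the stack).\<close>
datatype ('n, 't, 'f) item = Tm 't | Nt 'n "'f list"

record ('n, 't, 'f) igrammar =
  nonterms :: "'n set"
  terms :: "'t set"
  flags :: "'f set"
  prods :: "('n, 't, 'f) iprod set"
  start :: 'n

definition inst :: "'f list \<Rightarrow> ('n, 't) gsym list \<Rightarrow> ('n, 't, 'f) item list" where
  "inst \<sigma> \<alpha> = map (\<lambda>s. case s of Ter a \<Rightarrow> Tm a | NTer B \<Rightarrow> Nt B \<sigma>) \<alpha>"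

definition rhs_ok :: "('n, 't, 'f) igrammar \<Rightarrow> ('n, 't) gsym list \<Rightarrow> bool" where
  "rhs_ok G \<alpha> \<longleftrightarrow> (\<forall>s\<in>set \<alpha>. case s of Ter a \<Rightarrow> a \<in> terms G | NTer B \<Rightarrow> B \<in> nonterms G)"

definition prod_ok :: "('n, 't, 'f) igrammar \<Rightarrow> ('n, 't, 'f) iprod \<Rightarrow> bool" where
  "prod_ok G p \<longleftrightarrow> (case p of
      Copy A \<alpha> \<Rightarrow> A \<in> nonterms G \<and> rhs_ok G \<alpha>
    | Push A B f \<Rightarrow> A \<in> nonterms G \<and> B \<in> nonterms G \<and> f \<in> flags G
    | Pop A f \<alpha> \<Rightarrow> A \<in> nonterms G \<and> f \<in> flags G \<and> rhs_ok G \<alpha>)"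

definition wf_igrammar :: "('n, 't, 'f) igrammar \<Rightarrow> bool" where
  "wf_igrammar G \<longleftrightarrow> finite (nonterms G) \<and> finite (terms G) \<and> finite (flags G)
     \<and> finite (prods G) \<and> start G \<in> nonterms G \<and> (\<forall>p\<in>prods G. prod_ok G p)"

inductive istep :: "('n, 't, 'f) igrammar \<Rightarrow> ('n, 't, 'f) item list \<Rightarrow> ('n, 't, 'f) item list \<Rightarrow> bool"
  for G where
  copy: "Copy A \<alpha> \<in> prods G \<Longrightarrow> istep G (u @ [Nt A \<sigma>] @ v) (u @ inst \<sigma> \<alpha> @ v)"
| push: "Push A B f \<in> prods G \<Longrightarrow> istep G (u @ [Nt A \<sigma>] @ v) (u @ [Nt B (f # \<sigma>)] @ v)"
| pop: "Pop A f \<alpha> \<in> prods G \<Longrightarrow> istep G (u @ [Nt A (f # \<sigma>)] @ v) (u @ inst \<sigma> \<alpha> @ v)"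

definition ilang :: "('n, 't, 'f) igrammar \<Rightarrow> 't list set" where
  "ilang G = {w. w \<in> lists (terms G) \<and> (istep G)\<^sup>*\<^sup>* [Nt (start G) []] (map Tm w)}"

text \<open>Nonterminals and flags are taken from \<open>nat\<close> (any finite sets can be renamed into nat).\<close>
definition is_indexed_language :: "'t list set \<Rightarrow> bool" where
  "is_indexed_language L \<longleftrightarrow>
     (\<exists>G :: (nat, 't, nat) igrammar. wf_igrammar G \<and> ilang G = L)"

definition morph_ext :: "('b \<Rightarrow> 'b list) \<Rightarrow> 'b list \<Rightarrow> 'b list" where
  "morph_ext h x = concat (map h x)"

definition CD0L_system :: "'b set \<Rightarrow> ('b \<Rightarrow> 'b list) \<Rightarrow> 'b list \<Rightarrow> ('b \<Rightarrow> 'b) \<Rightarrow> bool" where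
  "CD0L_system A h w g \<longleftrightarrow> finite A \<and> (\<forall>a\<in>A. set (h a) \<subseteq> A) \<and> (\<forall>a\<in>A. g a \<in> A)
      \<and> w \<in> lists A"

definition CD0L_lang :: "('b \<Rightarrow> 'b list) \<Rightarrow> 'b list \<Rightarrow> ('b \<Rightarrow> 'b) \<Rightarrow> 'b list set" where
  "CD0L_lang h w g = {map g ((morph_ext h ^^ i) w) | i. True}"

text \<open>A language over letters of type 't is CD0L if it is the language of a CD0L system whose
  alphabet may use the letters of 't plus arbitrarily many fresh letters (Inr n).\<close>
definition is_CD0L_language :: "'t list set \<Rightarrow> bool" where
  "is_CD0L_language L \<longleftrightarrow>
     (\<exists>(A :: ('t + nat) set) h w g. CD0L_system A h w g \<and> CD0L_lang h w g = map Inl ` L)"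

end

theory Submission
  imports Defs
begin

text \<open>
  A branch of a derivation tree that always follows the longest yield has many nodes with a sibling
  of nonempty yield as soon as the derived word is long. The pushes and pops along a branch are
  matched as in a context-free derivation, and what the siblings can derive depends only on the
  type of the stack (which nonterminals derive a word, or a nonempty word, on it), of which there
  are finitely many. Pumping this context-free structure gives \<open>A[\<rho>] \<Rightarrow> x[\<rho>] A[\<sigma>\<rho>] y[\<rho>]\<close> and
  possibly \<open>D[\<sigma>\<rho>] \<Rightarrow> x'[\<rho>] D[\<rho>] y'[\<rho>]\<close>, where \<open>\<sigma>\<close> preserves the type and one of
  \<open>x, y, x', y'\<close> has a symbol with nonempty yield. Let \<open>h\<close> map each nonterminal \<open>B\<close> to a
  word \<open>v\<close> with \<open>B[\<sigma>\<rho>] \<Rightarrow> v[\<rho>]\<close>, and let two end markers produce \<open>x\<close> and \<open>y\<close>. The iterates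
  of \<open>h\<close> then follow derivations with stacks \<open>\<sigma>\<^sup>n\<sigma>\<^sub>0\<close>, and their terminal yields have unbounded
  length.
\<close>

section \<open>D0L systems with a morphic image\<close>

lemma morph_ext_append [simp]: "morph_ext h (x @ y) = morph_ext h x @ morph_ext h y"
  by (simp add: morph_ext_def)

lemma morph_ext_pow_append [simp]:
  "(morph_ext h ^^ n) (x @ y) = (morph_ext h ^^ n) x @ (morph_ext h ^^ n) y"
  by (induction n) auto

text \<open>The letter \<open>a\<close> is represented by the block of letters \<open>(a, j)\<close>, \<open>j < length (d a)\<close>; the
  first letter of a block carries the image of \<open>a\<close> and the others are erased. A letter with
  empty block disappears, which is harmless because of the assumption \<open>erase\<close>.\<close>

lemma CD0L_HD0L:
  fixes h :: "'b \<Rightarrow> 'b list" and d :: "'b \<Rightarrow> 't list"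
  assumes fin: "finite A" and h: "\<And>a. a \<in> A \<Longrightarrow> set (h a) \<subseteq> A" and w: "set w \<subseteq> A"
    and erase: "\<And>a. a \<in> A \<Longrightarrow> d a = [] \<Longrightarrow> concat (map d (h a)) = []"
  shows "is_CD0L_language {concat (map d ((morph_ext h ^^ i) w)) | i. True}"
proof -
  define K where "K = Sigma A (\<lambda>a. {..<length (d a)})"
  have "finite K" using fin by (simp add: K_def)
  then obtain f :: "'b \<times> nat \<Rightarrow> nat" where inj: "inj_on f K"
    using finite_imp_inj_to_nat_seg by blast
  define dec where "dec = inv_into K f"
  have dec: "dec (f k) = k" if "k \<in> K" for k
    using inj that by (simp add: dec_def)
  define rep :: "'b \<Rightarrow> ('t + nat) list" where
    "rep = (\<lambda>a. map (\<lambda>j. Inr (f (a, j))) [0..<length (d a)])"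
  define rep' where "rep' = (\<lambda>x. concat (map rep x))"
  define h' :: "'t + nat \<Rightarrow> ('t + nat) list" where
    "h' = case_sum (\<lambda>_. []) (\<lambda>n. case dec n of (a, j) \<Rightarrow> if j = 0 then rep' (h a) else [])"
  define g :: "'t + nat \<Rightarrow> 't + nat" where
    "g = case_sum Inl (\<lambda>n. case dec n of (a, j) \<Rightarrow> Inl (d a ! j))"
  \<comment> \<open>The letters \<open>Inl t\<close> are included because the coding
    \<open>g\<close> sends block letters to them and has to map \<open>A'\<close> into
    itself.\<close>
  define A' :: "('t + nat) set" where "A' = Inr ` f ` K \<union> Inl ` (\<Union>a\<in>A. set (d a))"
  have K: "(a, j) \<in> K \<longleftrightarrow> a \<in> A \<and> j < length (d a)" for a j by (auto simp: K_def)
  have g_rep: "map g (rep a) = map Inl (d a)" if "a \<in> A" for a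
    by (rule nth_equalityI) (use that in \<open>auto simp: rep_def g_def dec K\<close>)
  have g_rep': "map g (rep' x) = map Inl (concat (map d x))" if "set x \<subseteq> A" for x
    using that by (induction x) (auto simp: rep'_def g_rep)
  have rep_Nil: "rep' x = []" if "concat (map d x) = []" for x
    using that by (auto simp: rep'_def rep_def)
  have h_rep: "morph_ext h' (rep a) = rep' (h a)" if a: "a \<in> A" for a
  proof (cases "length (d a)")
    \<comment> \<open>An empty block has no first letter to carry the image of \<open>a\<close>. By
      \<open>erase\<close> that image has empty value, so its block word is empty as well.\<close>
    case 0
    then show ?thesis using rep_Nil[OF erase[OF a]] by (simp add: rep_def morph_ext_def)
  next
    case (Suc n)
    have "h' (Inr (f (a, j))) = (if j = 0 then rep' (h a) else [])" if "j < length (d a)" for j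
      using that a by (simp add: h'_def dec K)
    then have "map h' (rep a) = map (\<lambda>j. if j = 0 then rep' (h a) else []) [0..<Suc n]"
      unfolding rep_def Suc by (auto simp del: upt_Suc)
    also have "\<dots> = rep' (h a) # map (\<lambda>j. []) [1..<Suc n]"
      by (simp add: upt_conv_Cons del: upt_Suc)
    finally show ?thesis by (simp add: morph_ext_def)
  qed
  have h_rep': "morph_ext h' (rep' x) = rep' (morph_ext h x)" if "set x \<subseteq> A" for x
    using that
    by (induction x) (use h_rep in \<open>auto simp: rep'_def morph_ext_def\<close>)
  have closed: "set ((morph_ext h ^^ i) w) \<subseteq> A" for i
    by (induction i) (use w h in \<open>auto simp: morph_ext_def\<close>)
  have pow: "(morph_ext h' ^^ i) (rep' w) = rep' ((morph_ext h ^^ i) w)" for i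
    by (induction i) (use h_rep' closed in auto)
  have rep_A: "set (rep' x) \<subseteq> A'" if "set x \<subseteq> A" for x
    using that by (auto simp: rep'_def rep_def A'_def K)
  have "CD0L_system A' h' (rep' w) g"
    unfolding CD0L_system_def
  proof (intro conjI ballI)
    show "finite A'" using \<open>finite K\<close> fin by (simp add: A'_def)
    show "rep' w \<in> lists A'" using rep_A[OF w] by auto
    fix a assume "a \<in> A'"
    then consider (code) b j where "a = Inr (f (b, j))" "(b, j) \<in> K"
      | (letter) t where "a = Inl t" "t \<in> (\<Union>a\<in>A. set (d a))"
      by (auto simp: A'_def)
    then have "set (h' a) \<subseteq> A' \<and> g a \<in> A'"
    proof cases
      case code
      then have "set (h' a) \<subseteq> A'" using rep_A[OF h[of b]] by (auto simp: h'_def dec K)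
      have "g a = Inl (d b ! j)" using code by (simp add: g_def dec)
      then have "g a \<in> A'" using code by (force simp: K A'_def)
      with \<open>set (h' a) \<subseteq> A'\<close> show ?thesis by simp
    qed (auto simp: h'_def g_def A'_def)
    then show "set (h' a) \<subseteq> A'" "g a \<in> A'" by auto
  qed
  moreover have "CD0L_lang h' (rep' w) g =
      map Inl ` {concat (map d ((morph_ext h ^^ i) w)) | i. True}"
    using g_rep'[OF closed] by (auto simp: CD0L_lang_def pow)
  ultimately show ?thesis unfolding is_CD0L_language_def by blast
qed

section \<open>Pumping in one-letter context-free grammars\<close>

text \<open>\<open>ugen R0 R1 R2 S X k\<close>: a context-free grammar over a one-letter alphabet derives the word of
  length \<open>k\<close> from \<open>X\<close>, using only nonterminals in \<open>S\<close>.\<close>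

inductive ugen :: "('x \<Rightarrow> bool) \<Rightarrow> ('x \<Rightarrow> nat \<Rightarrow> 'x \<Rightarrow> bool) \<Rightarrow> ('x \<Rightarrow> nat \<Rightarrow> 'x \<Rightarrow> 'x \<Rightarrow> bool)
    \<Rightarrow> 'x set \<Rightarrow> 'x \<Rightarrow> nat \<Rightarrow> bool"
  for R0 R1 R2 S where
  leaf: "X \<in> S \<Longrightarrow> R0 X \<Longrightarrow> ugen R0 R1 R2 S X 0"
| unary: "X \<in> S \<Longrightarrow> R1 X m Y \<Longrightarrow> ugen R0 R1 R2 S Y k \<Longrightarrow> ugen R0 R1 R2 S X (m + k)"
| binary: "X \<in> S \<Longrightarrow> R2 X m Y Z \<Longrightarrow> ugen R0 R1 R2 S Y k \<Longrightarrow> ugen R0 R1 R2 S Z l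
    \<Longrightarrow> ugen R0 R1 R2 S X (m + k + l)"

lemma ugen_mono: "ugen R0 R1 R2 S X k \<Longrightarrow> S \<subseteq> S' \<Longrightarrow> ugen R0 R1 R2 S' X k"
  by (induction rule: ugen.induct) (auto intro: ugen.intros)

lemma ugen_mem: "ugen R0 R1 R2 S X k \<Longrightarrow> X \<in> S"
  by (induction rule: ugen.induct) auto

text \<open>Here \<open>C X Y a\<close> stands for a derivation of \<open>Y\<close> from \<open>X\<close> with \<open>a\<close> terminals around \<open>Y\<close>.\<close>

lemma unary_cfg_pumping:
  fixes R0 R1 R2 and C :: "'x \<Rightarrow> 'x \<Rightarrow> nat \<Rightarrow> bool"
  defines "gen \<equiv> ugen R0 R1 R2 UNIV"
  assumes fin: "finite F" and X0: "X0 \<in> F"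
    and R1_F: "\<And>X m Y. X \<in> F \<Longrightarrow> R1 X m Y \<Longrightarrow> Y \<in> F \<and> m \<le> 1"
    and R2_F: "\<And>X m Y Z. X \<in> F \<Longrightarrow> R2 X m Y Z \<Longrightarrow> Y \<in> F \<and> Z \<in> F \<and> m \<le> 1"
    and C_refl: "\<And>X. X \<in> F \<Longrightarrow> C X X 0"
    and C_trans: "\<And>X Y Z a b. C X Y a \<Longrightarrow> C Y Z b \<Longrightarrow> C X Z (a + b)"
    and C_R1: "\<And>X m Y. X \<in> F \<Longrightarrow> R1 X m Y \<Longrightarrow> C X Y m"
    and C_R2l: "\<And>X m Y Z k. X \<in> F \<Longrightarrow> R2 X m Y Z \<Longrightarrow> gen Z k \<Longrightarrow> C X Y (m + k)"
    and C_R2r: "\<And>X m Y Z k. X \<in> F \<Longrightarrow> R2 X m Y Z \<Longrightarrow> gen Y k \<Longrightarrow> C X Z (m + k)"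
    and unb: "\<And>n. \<exists>k\<ge>n. gen X0 k"
  shows "\<exists>X a b k. X \<in> F \<and> C X0 X a \<and> C X X b \<and> b > 0 \<and> gen X k"
proof (rule ccontr)
  assume "\<not> ?thesis"
  then have no_pump: "b = 0" if "X \<in> F" "C X0 X a" "C X X b" "gen X k" for X a b k
    using that by (metis neq0_conv)
  let ?g = "ugen R0 R1 R2"
  have gen: "gen X k" if "?g S X k" for S X k
    using that unfolding gen_def by (rule ugen_mono) simp
  \<comment> \<open>Applied with \<open>S - {Y}\<close>: derivations in which \<open>Y\<close>
    occurs at the root only. The disjunct \<open>k' = 0\<close> covers a leaf.\<close>
  define top where "top = (\<lambda>S Y k'. k' = 0 \<or>
      (\<exists>m Z k. R1 Y m Z \<and> ?g S Z k \<and> k' = m + k) \<or>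
      (\<exists>m Z Z' k l. R2 Y m Z Z' \<and> ?g S Z k \<and> ?g S Z' l \<and> k' = m + k + l))"
  \<comment> \<open>A derivation that contains \<open>Y\<close> is cut at a lowest occurrence of
    \<open>Y\<close>; everything outside that subtree goes into the context.\<close>
  have split: "?g (S - {Y}) X k \<or> (\<exists>a k'. C X Y a \<and> k = a + k' \<and> top (S - {Y}) Y k')"
    if "?g S X k" "S \<subseteq> F" for S X Y k
    using that
  proof (induction rule: ugen.induct)
    case (leaf X)
    show ?case
    proof (cases "X = Y")
      case True
      then show ?thesis using leaf C_refl by (force simp: top_def)
    qed (use leaf in \<open>auto intro: ugen.leaf\<close>)
  next
    case (unary X m Z k)
    then have XF: "X \<in> F" by auto
    from unary consider "?g (S - {Y}) Z k"
      | a k' where "C Z Y a" "k = a + k'" "top (S - {Y}) Y k'" by blast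
    then show ?case
    proof cases
      case 1
      show ?thesis
      proof (cases "X = Y")
        case True
        then have "C X Y 0" using C_refl XF by blast
        moreover have "top (S - {Y}) Y (m + k)"
          using True 1 unary(2) unfolding top_def by blast
        ultimately show ?thesis by (metis add_0)
      qed (use 1 unary in \<open>auto intro: ugen.unary\<close>)
    next
      case 2
      then have "C X Y (m + a)" using C_trans C_R1 XF unary by blast
      then show ?thesis using 2 by (metis add.assoc)
    qed
  next
    case (binary X m Z Z' k l)
    then have XF: "X \<in> F" by auto
    from binary consider "?g (S - {Y}) Z k" "?g (S - {Y}) Z' l"
      | a k' where "C Z Y a" "k = a + k'" "top (S - {Y}) Y k'"
      | a k' where "C Z' Y a" "l = a + k'" "top (S - {Y}) Y k'" by blast
    then show ?case
    proof cases
      case 1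
      show ?thesis
      proof (cases "X = Y")
        case True
        then have "C X Y 0" using C_refl XF by blast
        moreover have "top (S - {Y}) Y (m + k + l)"
          using True 1 binary(2) unfolding top_def by blast
        ultimately show ?thesis by (metis add_0)
      qed (use 1 binary in \<open>auto intro: ugen.binary\<close>)
    next
      case 2
      then have "C X Y (m + l + a)"
        using C_trans C_R2l XF binary(2) gen[OF binary(4)] by blast
      moreover have "m + k + l = (m + l + a) + k'" using 2 by simp
      ultimately show ?thesis using 2 by blast
    next
      case 3
      then have "C X Y (m + k + a)"
        using C_trans C_R2r XF binary(2) gen[OF binary(3)] by blast
      moreover have "m + k + l = (m + k + a) + k'" using 3 by simp
      ultimately show ?thesis using 3 by blast
    qed
  qed
  define S0 where "S0 = {X \<in> F. \<exists>a. C X0 X a}"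
  \<comment> \<open>Cutting a derivation at its own root symbol \<open>X\<close> gives a loop, which
    has weight 0 by \<open>no_pump\<close>. The whole yield then comes from one root step into
    derivations that avoid \<open>X\<close>, and these are bounded by induction on the set of
    symbols.\<close>
  have bound: "\<exists>N. \<forall>X k. ?g S X k \<longrightarrow> k \<le> N" if "finite S" "S \<subseteq> S0" for S
    using that
  proof (induction S rule: finite_psubset_induct)
    case (psubset S)
    have "\<exists>N. \<forall>X k. ?g (S - {Y}) X k \<longrightarrow> k \<le> N" if "Y \<in> S" for Y
      using psubset that by (intro psubset.IH) auto
    then obtain N where N: "\<And>Y X k. Y \<in> S \<Longrightarrow> ?g (S - {Y}) X k \<Longrightarrow> k \<le> N Y" by metis
    define M where "M = sum N S"
    have M: "k \<le> M" if "Y \<in> S" "?g (S - {Y}) X k" for Y X k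
      using N[OF that] member_le_sum[of Y S N] psubset(1) that(1) by (auto simp: M_def)
    have "k \<le> 1 + M + M" if g: "?g S X k" for X k
    proof -
      have X: "X \<in> S" using g by (rule ugen_mem)
      then have XF: "X \<in> F" "\<exists>a. C X0 X a" using psubset by (auto simp: S0_def)
      have "\<not> ?g (S - {X}) X k" using ugen_mem by fastforce
      then obtain a k' where "C X X a" "k = a + k'" and top: "top (S - {X}) X k'"
        using split[OF g, of X] psubset(3) by (auto simp: S0_def)
      moreover have "a = 0" using no_pump XF \<open>C X X a\<close> gen[OF g] by blast
      ultimately have "k = k'" by simp
      moreover have "k' \<le> 1 + M + M"
        using top unfolding top_def
      proof (elim disjE exE conjE)
        fix m Z l assume "R1 X m Z" "?g (S - {X}) Z l" "k' = m + l"
        then show ?thesis using M[OF X, of Z l] R1_F[OF XF(1), of m Z] by simp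
      next
        fix m Z Z' l l' assume "R2 X m Z Z'" "?g (S - {X}) Z l" "?g (S - {X}) Z' l'" "k' = m + l + l'"
        then show ?thesis using M[OF X, of Z l] M[OF X, of Z' l'] R2_F[OF XF(1), of m Z Z'] by simp
      qed simp
      ultimately show ?thesis by simp
    qed
    then show ?case by blast
  qed
  \<comment> \<open>Children of reachable symbols are reachable: the sibling subtree derives some
    length and thus completes a context.\<close>
  have reach: "?g S0 X k" if "gen X k" "X \<in> S0" for X k
    using that unfolding gen_def
  proof (induction rule: ugen.induct)
    case (unary X m Y k)
    then have "Y \<in> S0" using R1_F C_R1 C_trans unfolding S0_def by blast
    then show ?case using unary by (auto intro: ugen.unary)
  next
    case (binary X m Y Z k l)
    then obtain a where X: "X \<in> F" "C X0 X a" by (auto simp: S0_def)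
    have "C X Y (m + l)" "C X Z (m + k)"
      using C_R2l[OF X(1) binary(2)] C_R2r[OF X(1) binary(2)] binary(3,4) by (auto simp: gen_def)
    then have "Y \<in> S0" "Z \<in> S0"
      using R2_F[OF X(1) binary(2)] C_trans[OF X(2)] by (auto simp: S0_def)
    then show ?case using binary by (auto intro: ugen.binary)
  qed (auto intro: ugen.leaf)
  have "X0 \<in> S0" using X0 C_refl by (auto simp: S0_def)
  moreover obtain N where "\<forall>X k. ?g S0 X k \<longrightarrow> k \<le> N"
    using bound[of S0] fin by (auto simp: S0_def)
  ultimately show False using unb[of "Suc N"] reach by (meson not_less_eq_eq)
qed

section \<open>Derivations relative to a stack\<close>

text \<open>The type of a stack: the nonterminals that derive a terminal word on top of it, and those that
  derive a nonempty one.\<close>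

type_synonym 'n stype = "'n set \<times> 'n set"

definition productive :: "'n stype \<Rightarrow> ('n, 't) gsym list \<Rightarrow> bool" where
  "productive t v \<longleftrightarrow> (\<forall>B. NTer B \<in> set v \<longrightarrow> B \<in> fst t)"

definition visible :: "'n stype \<Rightarrow> ('n, 't) gsym list \<Rightarrow> bool" where
  "visible t v \<longleftrightarrow> (\<exists>s\<in>set v. case s of Ter a \<Rightarrow> True | NTer B \<Rightarrow> B \<in> snd t)"

lemma productive_simps [simp]:
  "productive t []"
  "productive t (Ter a # v) \<longleftrightarrow> productive t v"
  "productive t (NTer B # v) \<longleftrightarrow> B \<in> fst t \<and> productive t v"
  "productive t (u @ v) \<longleftrightarrow> productive t u \<and> productive t v"
  by (auto simp: productive_def)

lemma visible_simps [simp]: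
  "\<not> visible t []"
  "visible t (Ter a # v)"
  "visible t (NTer B # v) \<longleftrightarrow> B \<in> snd t \<or> visible t v"
  "visible t (u @ v) \<longleftrightarrow> visible t u \<or> visible t v"
  by (auto simp: visible_def)

text \<open>The pair \<open>({}, {})\<close> serves as the type below the bottom of a stack, where
  only terminal words count as finished.\<close>

lemma productive_empty_iff: "productive ({}, {}) v \<longleftrightarrow> (\<exists>w. v = map Ter w)"
proof
  show "productive ({}, {}) v \<Longrightarrow> \<exists>w. v = map Ter w"
  proof (induction v)
    case (Cons s v)
    then show ?case by (cases s) (auto intro: exI[of _ "_ # _"])
  qed auto
qed (auto simp: productive_def)

lemma visible_map_Ter [simp]: "visible t (map Ter w) \<longleftrightarrow> w \<noteq> []"
  by (cases w) auto

lemma productive_map_Ter [simp]: "productive t (map Ter w)"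
  by (auto simp: productive_def)

locale indexed_grammar =
  fixes G :: "('n, 't, 'f) igrammar"
  assumes wf: "wf_igrammar G"
begin

text \<open>\<open>expands \<alpha> \<sigma> v\<close>: for every stack \<open>\<rho>\<close>, the word \<open>\<alpha>\<close> with stack \<open>\<sigma> @ \<rho>\<close> on all its
  nonterminals derives \<open>v\<close> with stack \<open>\<rho>\<close>.\<close>

inductive expands :: "('n, 't) gsym list \<Rightarrow> 'f list \<Rightarrow> ('n, 't) gsym list \<Rightarrow> bool" where
  Nil: "expands [] \<sigma> []"
| Ter: "expands \<alpha> \<sigma> v \<Longrightarrow> expands (Ter a # \<alpha>) \<sigma> (Ter a # v)"
| Base: "expands \<alpha> [] v \<Longrightarrow> expands (NTer B # \<alpha>) [] (NTer B # v)"
| Copy: "Copy B \<beta> \<in> prods G \<Longrightarrow> expands \<beta> \<sigma> u \<Longrightarrow> expands \<alpha> \<sigma> v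
    \<Longrightarrow> expands (NTer B # \<alpha>) \<sigma> (u @ v)"
| Push: "Push B D f \<in> prods G \<Longrightarrow> expands [NTer D] (f # \<sigma>) u \<Longrightarrow> expands \<alpha> \<sigma> v
    \<Longrightarrow> expands (NTer B # \<alpha>) \<sigma> (u @ v)"
| Pop: "Pop B f \<beta> \<in> prods G \<Longrightarrow> expands \<beta> \<sigma> u \<Longrightarrow> expands \<alpha> (f # \<sigma>) v
    \<Longrightarrow> expands (NTer B # \<alpha>) (f # \<sigma>) (u @ v)"

inductive_cases expands_NilE [elim!]: "expands [] \<sigma> v"
inductive_cases expands_TerE [elim!]: "expands (Ter a # \<alpha>) \<sigma> v"

lemma expands_refl: "expands \<alpha> [] \<alpha>"
proof (induction \<alpha>)
  case (Cons s \<alpha>)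
  then show ?case by (cases s) (auto intro: Ter Base)
qed (rule Nil)

lemma expands_append: "expands \<alpha> \<sigma> u \<Longrightarrow> expands \<beta> \<sigma> v \<Longrightarrow> expands (\<alpha> @ \<beta>) \<sigma> (u @ v)"
proof (induction rule: expands.induct)
  case (Copy B \<gamma> \<sigma> u \<alpha> v')
  then show ?case using expands.Copy[OF Copy(1,2)] by simp
next
  case (Push B D f \<sigma> u \<alpha> v')
  then show ?case using expands.Push[OF Push(1,2)] by simp
next
  case (Pop B f \<gamma> \<sigma> u \<alpha> v')
  then show ?case using expands.Pop[OF Pop(1,2)] by simp
qed (auto intro: expands.intros)

lemma expands_Copy: "Copy B \<beta> \<in> prods G \<Longrightarrow> expands \<beta> \<sigma> u \<Longrightarrow> expands [NTer B] \<sigma> u"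
  using Copy[OF _ _ Nil] by fastforce

lemma expands_Push: "Push B D f \<in> prods G \<Longrightarrow> expands [NTer D] (f # \<sigma>) u \<Longrightarrow> expands [NTer B] \<sigma> u"
  using Push[OF _ _ Nil] by fastforce

lemma expands_Pop: "Pop B f \<beta> \<in> prods G \<Longrightarrow> expands \<beta> \<sigma> u \<Longrightarrow> expands [NTer B] (f # \<sigma>) u"
  using Pop[OF _ _ Nil] by fastforce

lemma expands_Cons_split:
  assumes "expands (s # \<alpha>) \<sigma> v"
  obtains u w where "v = u @ w" "expands [s] \<sigma> u" "expands \<alpha> \<sigma> w"
  using assms
proof cases
  case (Ter v a)
  then show ?thesis using that[of "[Ter a]" v] by (auto intro: expands.intros)
next
  case (Base v B)
  then show ?thesis using that[of "[NTer B]" v] by (auto intro: expands.intros)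
next
  case (Copy B \<beta> u v)
  then show ?thesis using that expands_Copy by blast
next
  case (Push B D f u v)
  then show ?thesis using that expands_Push by blast
next
  case (Pop B f \<beta> \<sigma> u v)
  then show ?thesis using that expands_Pop by blast
qed

lemma expands_append_split:
  assumes "expands (\<alpha> @ \<beta>) \<sigma> v"
  obtains u w where "v = u @ w" "expands \<alpha> \<sigma> u" "expands \<beta> \<sigma> w"
proof -
  have "\<exists>u w. v = u @ w \<and> expands \<alpha> \<sigma> u \<and> expands \<beta> \<sigma> w"
    using assms
  proof (induction \<alpha> arbitrary: v)
    case (Cons s \<alpha>)
    then obtain u w where "v = u @ w" "expands [s] \<sigma> u" "expands (\<alpha> @ \<beta>) \<sigma> w"
      by (auto elim: expands_Cons_split)
    moreover from this Cons.IH obtain u' w' where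
      "w = u' @ w'" "expands \<alpha> \<sigma> u'" "expands \<beta> \<sigma> w'" by blast
    ultimately show ?case using expands_append[of "[s]" \<sigma> u \<alpha> u']
      by (intro exI[of _ "u @ u'"] exI[of _ w']) auto
  qed (auto intro: expands.intros)
  then show ?thesis using that by blast
qed

text \<open>A nonterminal left by the first derivation carries exactly the stack on which the second
  one starts, so the two trees can be glued leaf by leaf.\<close>

lemma expands_trans: "expands \<alpha> \<sigma> v \<Longrightarrow> expands v \<rho> u \<Longrightarrow> expands \<alpha> (\<sigma> @ \<rho>) u"
proof (induction arbitrary: u rule: expands.induct)
  case (Ter \<alpha> \<sigma> v a)
  then show ?case by (auto intro: expands.Ter)
next
  case (Base \<alpha> v B)
  from Base.prems obtain u1 u2 where "u = u1 @ u2" "expands [NTer B] \<rho> u1" "expands v \<rho> u2"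
    by (rule expands_Cons_split)
  then show ?case using Base.IH expands_append[of "[NTer B]" \<rho> u1 \<alpha> u2] by simp
next
  case (Copy B \<beta> \<sigma> v1 \<alpha> v2)
  from Copy.prems obtain u1 u2 where "u = u1 @ u2" "expands v1 \<rho> u1" "expands v2 \<rho> u2"
    by (rule expands_append_split)
  then show ?case using Copy by (auto intro: expands.Copy)
next
  case (Push B D f \<sigma> v1 \<alpha> v2)
  from Push.prems obtain u1 u2 where "u = u1 @ u2" "expands v1 \<rho> u1" "expands v2 \<rho> u2"
    by (rule expands_append_split)
  then show ?case using Push by (auto intro: expands.Push)
next
  case (Pop B f \<beta> \<sigma> v1 \<alpha> v2)
  from Pop.prems obtain u1 u2 where "u = u1 @ u2" "expands v1 \<rho> u1" "expands v2 \<rho> u2"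
    by (rule expands_append_split)
  then show ?case using Pop by (auto intro: expands.Pop)
qed (auto intro: expands.Nil)

text \<open>Each branch is cut just before it first pops a flag of \<rho>; the symbols standing at
  the cuts form the intermediate word.\<close>

lemma expands_stack_split:
  assumes "expands \<alpha> (\<sigma> @ \<rho>) u"
  obtains v where "expands \<alpha> \<sigma> v" "expands v \<rho> u"
proof -
  have "\<exists>v. expands \<alpha> \<sigma> v \<and> expands v \<rho> u" if "expands \<alpha> \<tau> u" "\<tau> = \<sigma> @ \<rho>" for \<tau>
    using that
  proof (induction arbitrary: \<sigma> rule: expands.induct)
    case (Nil \<tau>)
    then show ?case by (blast intro: expands.Nil)
  next
    case (Ter \<alpha> \<tau> v a)
    then show ?case by (blast intro: expands.Ter)
  next
    case (Base \<alpha> v B)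
    then have "\<sigma> = []" "\<rho> = []" by auto
    then show ?case using Base by (blast intro: expands.Base expands_refl)
  next
    case (Copy B \<beta> \<tau> u1 \<alpha> u2)
    then obtain v1 v2 where "expands \<beta> \<sigma> v1" "expands v1 \<rho> u1" "expands \<alpha> \<sigma> v2" "expands v2 \<rho> u2"
      by blast
    then show ?case using Copy(1) by (blast intro: expands.Copy expands_append)
  next
    case (Push B D f \<tau> u1 \<alpha> u2)
    then obtain v1 v2 where "expands [NTer D] (f # \<sigma>) v1" "expands v1 \<rho> u1"
      "expands \<alpha> \<sigma> v2" "expands v2 \<rho> u2"
      by (metis append_Cons)
    then show ?case using Push(1) by (blast intro: expands.Push expands_append)
  next
    case (Pop B f \<beta> \<tau> u1 \<alpha> u2)
    from Pop obtain v2 where v2: "expands \<alpha> \<sigma> v2" "expands v2 \<rho> u2" by blast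
    show ?case
    proof (cases \<sigma>)
      \<comment> \<open>The pop already consumes a flag of \<rho>, so \<open>B\<close> is left
        standing and the pop is moved to the second derivation.\<close>
      case Nil
      then have "expands (NTer B # v2) \<rho> (u1 @ u2)"
        using Pop v2 by (auto intro: expands.Pop)
      moreover have "expands (NTer B # \<alpha>) \<sigma> (NTer B # v2)"
        using Nil v2 by (auto intro: expands.Base)
      ultimately show ?thesis by blast
    next
      case (Cons f' \<sigma>')
      then obtain v1 where "expands \<beta> \<sigma>' v1" "expands v1 \<rho> u1" using Pop by auto
      then show ?thesis using Cons Pop(1,5) Pop.prems v2
        by (auto intro!: exI[of _ "v1 @ v2"] expands.Pop expands_append)
    qed
  qed
  then show ?thesis using assms that by blast
qed

section \<open>Relative derivations and the rewriting relation of the grammar\<close>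

lemma rhs_ok_append [simp]: "rhs_ok G (\<alpha> @ \<beta>) \<longleftrightarrow> rhs_ok G \<alpha> \<and> rhs_ok G \<beta>"
  by (auto simp: rhs_ok_def)

lemma prods_ok:
  "Copy A \<beta> \<in> prods G \<Longrightarrow> A \<in> nonterms G \<and> rhs_ok G \<beta>"
  "Push A B f \<in> prods G \<Longrightarrow> A \<in> nonterms G \<and> B \<in> nonterms G"
  "Pop A f \<beta> \<in> prods G \<Longrightarrow> A \<in> nonterms G \<and> rhs_ok G \<beta>"
  using wf by (auto simp: wf_igrammar_def prod_ok_def split: iprod.splits)

lemma rhs_ok_simps [simp]:
  "rhs_ok G []" "rhs_ok G (Ter a # \<alpha>) \<longleftrightarrow> a \<in> terms G \<and> rhs_ok G \<alpha>"
  "rhs_ok G (NTer B # \<alpha>) \<longleftrightarrow> B \<in> nonterms G \<and> rhs_ok G \<alpha>"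
  by (auto simp: rhs_ok_def)

lemma rhs_ok_expands: "expands \<alpha> \<sigma> v \<Longrightarrow> rhs_ok G \<alpha> \<Longrightarrow> rhs_ok G v"
  by (induction rule: expands.induct) (auto dest: prods_ok)

lemma expands_nonterm: "expands [NTer A] \<sigma> v \<Longrightarrow> A \<notin> nonterms G \<Longrightarrow> v = [NTer A]"
  by (erule expands.cases) (auto dest: prods_ok)

lemma inst_simps [simp]:
  "inst \<sigma> [] = []" "inst \<sigma> (Ter a # \<alpha>) = Tm a # inst \<sigma> \<alpha>"
  "inst \<sigma> (NTer B # \<alpha>) = Nt B \<sigma> # inst \<sigma> \<alpha>" "inst \<sigma> (\<alpha> @ \<beta>) = inst \<sigma> \<alpha> @ inst \<sigma> \<beta>"
  by (auto simp: inst_def)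

lemma inst_map_Ter [simp]: "inst \<sigma> (map Ter w) = map Tm w"
  by (induction w) auto

lemma istep_context: "istep G x y \<Longrightarrow> istep G (p @ x @ q) (p @ y @ q)"
proof (induction rule: istep.induct)
  case (copy A \<alpha> u \<sigma> v)
  then show ?case using istep.copy[of A \<alpha> G "p @ u" \<sigma> "v @ q"] by simp
next
  case (push A B f u \<sigma> v)
  then show ?case using istep.push[of A B f G "p @ u" \<sigma> "v @ q"] by simp
next
  case (pop A f \<alpha> u \<sigma> v)
  then show ?case using istep.pop[of A f \<alpha> G "p @ u" \<sigma> "v @ q"] by simp
qed

lemma isteps_context: "(istep G)\<^sup>*\<^sup>* x y \<Longrightarrow> (istep G)\<^sup>*\<^sup>* (p @ x @ q) (p @ y @ q)"
  by (induction rule: rtranclp_induct) (auto intro: rtranclp.rtrancl_into_rtrancl istep_context)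

lemma isteps_append:
  "(istep G)\<^sup>*\<^sup>* x x' \<Longrightarrow> (istep G)\<^sup>*\<^sup>* y y' \<Longrightarrow> (istep G)\<^sup>*\<^sup>* (x @ y) (x' @ y')"
  using isteps_context[of x x' "[]" y] isteps_context[of y y' x' "[]"] by simp

lemma expands_isteps: "expands \<alpha> \<sigma> v \<Longrightarrow> (istep G)\<^sup>*\<^sup>* (inst \<sigma> \<alpha>) (inst [] v)"
proof (induction rule: expands.induct)
  case (Ter \<alpha> \<sigma> v a)
  then show ?case using isteps_context[of _ _ "[Tm a]" "[]"] by simp
next
  case (Base \<alpha> v B)
  then show ?case using isteps_context[of _ _ "[Nt B []]" "[]"] by simp
next
  case (Copy B \<beta> \<sigma> u \<alpha> v)
  have "istep G [Nt B \<sigma>] (inst \<sigma> \<beta>)" using istep.copy[OF Copy(1), of "[]" \<sigma> "[]"] by simp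
  then show ?case using Copy isteps_append[of "[Nt B \<sigma>]"]
    by (simp add: converse_rtranclp_into_rtranclp)
next
  case (Push B D f \<sigma> u \<alpha> v)
  have "istep G [Nt B \<sigma>] [Nt D (f # \<sigma>)]" using istep.push[OF Push(1), of "[]" \<sigma> "[]"] by simp
  then show ?case using Push isteps_append[of "[Nt B \<sigma>]"]
    by (simp add: converse_rtranclp_into_rtranclp)
next
  case (Pop B f \<beta> \<sigma> u \<alpha> v)
  have "istep G [Nt B (f # \<sigma>)] (inst \<sigma> \<beta>)" using istep.pop[OF Pop(1), of "[]" \<sigma> "[]"] by simp
  then show ?case using Pop isteps_append[of "[Nt B (f # \<sigma>)]"]
    by (simp add: converse_rtranclp_into_rtranclp)
qed simp

text \<open>An invariant for reading a rewriting sequence backwards: in a sentential form the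
  nonterminals carry different stacks, so each item is given its own factor of the terminal
  word.\<close>

fun item_yields :: "('n, 't, 'f) item list \<Rightarrow> 't list \<Rightarrow> bool" where
  "item_yields [] w \<longleftrightarrow> w = []"
| "item_yields (Tm a # is) w \<longleftrightarrow> (\<exists>v. w = a # v \<and> item_yields is v)"
| "item_yields (Nt B \<sigma> # is) w \<longleftrightarrow>
    (\<exists>u v. w = u @ v \<and> expands [NTer B] \<sigma> (map Ter u) \<and> item_yields is v)"

lemma item_yields_append:
  "item_yields (x @ y) w \<longleftrightarrow> (\<exists>u v. w = u @ v \<and> item_yields x u \<and> item_yields y v)"
proof (induction x w rule: item_yields.induct)
  case (2 a "is" w)
  then show ?case by (auto simp: Cons_eq_append_conv) blast+
next
  case (3 B \<sigma> "is" w)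
  then show ?case by (auto) (metis append.assoc)+
qed auto

lemma item_yields_inst: "item_yields (inst \<sigma> \<alpha>) w \<Longrightarrow> expands \<alpha> \<sigma> (map Ter w)"
proof (induction \<alpha> arbitrary: w)
  case (Cons s \<alpha>)
  show ?case
  proof (cases s)
    case (NTer B)
    then obtain u v where "w = u @ v" "expands [NTer B] \<sigma> (map Ter u)" "item_yields (inst \<sigma> \<alpha>) v"
      using Cons.prems by auto
    then show ?thesis using NTer Cons.IH expands_append[of "[NTer B]"] by fastforce
  next
    case (Ter a)
    then obtain v where "w = a # v" "item_yields (inst \<sigma> \<alpha>) v" using Cons.prems by auto
    then show ?thesis using Ter Cons.IH by (simp add: expands.Ter)
  qed
qed (auto intro: expands.Nil)

lemma item_yields_replace:
  assumes y: "\<And>b. item_yields y b \<Longrightarrow> expands [NTer A] \<sigma> (map Ter b)"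
    and w: "item_yields (u @ y @ v) w"
  shows "item_yields (u @ [Nt A \<sigma>] @ v) w"
proof -
  from w obtain a b c where abc: "w = a @ b @ c" "item_yields u a" "item_yields y b" "item_yields v c"
    unfolding item_yields_append by blast
  then have "item_yields (Nt A \<sigma> # v) (b @ c)" using y by auto
  then show ?thesis using abc unfolding item_yields_append[of u] by auto
qed

lemma item_yields_istep: "istep G x y \<Longrightarrow> item_yields y w \<Longrightarrow> item_yields x w"
proof (induction rule: istep.induct)
  case (copy A \<alpha> u \<sigma> v)
  show ?case using copy.prems
    by (rule item_yields_replace[rotated]) (rule expands_Copy[OF copy(1) item_yields_inst])
next
  case (push A B f u \<sigma> v)
  show ?case using push.prems
    by (rule item_yields_replace[rotated]) (auto intro: expands_Push[OF push(1)])
next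
  case (pop A f \<alpha> u \<sigma> v)
  show ?case using pop.prems
    by (rule item_yields_replace[rotated]) (rule expands_Pop[OF pop(1) item_yields_inst])
qed

lemma item_yields_map_Tm: "item_yields (map Tm w) w"
  by (induction w) auto

lemma ilang_iff: "w \<in> ilang G \<longleftrightarrow> expands [NTer (start G)] [] (map Ter w)"
proof
  assume "w \<in> ilang G"
  then have "(istep G)\<^sup>*\<^sup>* [Nt (start G) []] (map Tm w)" by (simp add: ilang_def)
  then have "item_yields [Nt (start G) []] w"
    by (induction rule: converse_rtranclp_induct) (auto intro: item_yields_map_Tm item_yields_istep)
  then show "expands [NTer (start G)] [] (map Ter w)" by auto
next
  assume e: "expands [NTer (start G)] [] (map Ter w)"
  have "rhs_ok G [NTer (start G)]" using wf by (simp add: rhs_ok_def wf_igrammar_def)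
  then have "rhs_ok G (map Ter w)" using rhs_ok_expands[OF e] by blast
  then have "w \<in> lists (terms G)" by (auto simp: rhs_ok_def)
  then show "w \<in> ilang G" using expands_isteps[OF e] by (simp add: ilang_def)
qed

section \<open>Stack types and derivation contexts\<close>

text \<open>The transition map of stack types: it computes the type of
  \<open>\<sigma> @ \<rho>\<close> from the type \<open>t\<close> of \<rho>. Only the word standing
  when \<sigma> is exhausted is tested against \<open>t\<close>.\<close>

definition lift :: "'f list \<Rightarrow> 'n stype \<Rightarrow> 'n stype" where
  "lift \<sigma> t =
    ({A. \<exists>v. expands [NTer A] \<sigma> v \<and> productive t v},
     {A. \<exists>v. expands [NTer A] \<sigma> v \<and> productive t v \<and> visible t v})"

lemma expands_productive:
  "expands x \<sigma> x' \<Longrightarrow> productive t x' \<Longrightarrow>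
    productive (lift \<sigma> t) x \<and> (visible t x' \<longrightarrow> visible (lift \<sigma> t) x)"
proof (induction x arbitrary: x')
  case (Cons s x)
  from Cons.prems(1) obtain u w where "x' = u @ w" "expands [s] \<sigma> u" "expands x \<sigma> w"
    by (rule expands_Cons_split)
  then show ?case using Cons by (cases s) (auto simp: lift_def)
qed auto

text \<open>The letters are expanded independently, each by a visible word where its type allows one
  and by a merely productive word otherwise.\<close>

lemma productive_expands:
  "productive (lift \<sigma> t) x \<Longrightarrow>
    \<exists>x'. expands x \<sigma> x' \<and> productive t x' \<and> (visible (lift \<sigma> t) x \<longrightarrow> visible t x')"
proof (induction x)
  case (Cons s x)
  then obtain x' where x': "expands x \<sigma> x'" "productive t x'"
    "visible (lift \<sigma> t) x \<longrightarrow> visible t x'"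
    by (cases s) auto
  obtain u where "expands [s] \<sigma> u" "productive t u" "visible (lift \<sigma> t) [s] \<longrightarrow> visible t u"
  proof (cases s)
    case (Ter a)
    then show ?thesis using that[of "[Ter a]"] by (auto intro: expands.intros)
  next
    case (NTer B)
    then show ?thesis using Cons.prems that by (cases "B \<in> snd (lift \<sigma> t)") (auto simp: lift_def)
  qed
  then have "expands (s # x) \<sigma> (u @ x')" "productive t (u @ x')"
    "visible (lift \<sigma> t) (s # x) \<longrightarrow> visible t (u @ x')"
    using x' expands_append[of "[s]" \<sigma> u x x'] by (cases s; auto)+
  then show ?case by blast
qed (auto intro: expands.Nil)

lemma lift_append: "lift (\<sigma> @ \<rho>) t = lift \<sigma> (lift \<rho> t)"
proof -
  \<comment> \<open>\<open>P\<close> treats both components at once: \<open>False\<close> gives the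
    first and \<open>True\<close> the second.\<close>
  have "(\<exists>u. expands x (\<sigma> @ \<rho>) u \<and> productive t u \<and> (P \<longrightarrow> visible t u)) \<longleftrightarrow>
    (\<exists>v. expands x \<sigma> v \<and> productive (lift \<rho> t) v \<and> (P \<longrightarrow> visible (lift \<rho> t) v))" for x P
    by (meson expands_stack_split expands_trans expands_productive productive_expands)
  from this[of _ True] this[of _ False] show ?thesis unfolding lift_def[of "\<sigma> @ \<rho>"] lift_def[of \<sigma>]
    by simp
qed

text \<open>A symbol outside \<open>nonterms G\<close> has no production and can only expand to
  itself. Hence the types that occur range over a finite set.\<close>

lemma lift_subset:
  assumes "fst t \<subseteq> nonterms G"
  shows "fst (lift \<sigma> t) \<subseteq> nonterms G" "snd (lift \<sigma> t) \<subseteq> nonterms G"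
  using assms expands_nonterm by (fastforce simp: lift_def)+

text \<open>\<open>A[\<rho>]\<close> derives \<open>x[\<rho>] B[\<sigma> @ \<rho>] y[\<rho>]\<close> for every \<open>\<rho>\<close>.\<close>

definition embeds where
  "embeds \<sigma> A x B y \<longleftrightarrow> (\<forall>\<rho> u p q. expands [NTer B] (\<sigma> @ \<rho>) u \<longrightarrow> expands x \<rho> p \<longrightarrow>
    expands y \<rho> q \<longrightarrow> expands [NTer A] \<rho> (p @ u @ q))"

text \<open>The side words of the inner context sit on the longer stack; they are expanded along
  \<sigma> to \<open>p\<close> and \<open>q\<close> before they join the outer side words.\<close>

lemma embeds_trans:
  assumes 1: "embeds \<sigma> A x B y" and 2: "embeds \<sigma>' B x' D y'"
    and p: "expands x' \<sigma> p" and q: "expands y' \<sigma> q"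
  shows "embeds (\<sigma>' @ \<sigma>) A (x @ p) D (q @ y)"
  unfolding embeds_def
proof (intro allI impI)
  fix \<rho> u p' q'
  assume u: "expands [NTer D] ((\<sigma>' @ \<sigma>) @ \<rho>) u"
    and "expands (x @ p) \<rho> p'" "expands (q @ y) \<rho> q'"
  then obtain p1 p2 q1 q2 where
    pq: "p' = p1 @ p2" "expands x \<rho> p1" "expands p \<rho> p2"
      "q' = q1 @ q2" "expands q \<rho> q1" "expands y \<rho> q2"
    by (auto elim!: expands_append_split)
  have "expands [NTer B] (\<sigma> @ \<rho>) (p2 @ u @ q1)"
    using 2 u expands_trans[OF p pq(3)] expands_trans[OF q pq(5)] by (auto simp: embeds_def)
  then have "expands [NTer A] \<rho> (p1 @ (p2 @ u @ q1) @ q2)"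
    using 1 pq unfolding embeds_def by blast
  then show "expands [NTer A] \<rho> (p' @ u @ q')" using pq by simp
qed

lemma embeds_Nil_expands: "embeds [] A x B y \<Longrightarrow> expands [NTer A] [] (x @ NTer B # y)"
  using expands_refl unfolding embeds_def by (metis append_Cons append_Nil)

text \<open>The branch continues at the child \<open>D\<close>. The weight \<open>m = 1\<close> may
  be counted only at a visible sibling, while \<open>m = 0\<close> is always allowed, so weights are
  lower estimates.\<close>

definition selects where
  "selects t \<beta> m D \<longleftrightarrow> m \<le> (1::nat) \<and> (\<exists>x y. \<beta> = x @ NTer D # y \<and>
    productive t x \<and> productive t y \<and> (m > 0 \<longrightarrow> visible t (x @ y)))"

text \<open>Of the weight of a piece of branch only its positivity is remembered, since one visible
  symbol beside the loop suffices for pumping.\<close>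

definition segment where
  "segment t A n B \<longleftrightarrow> (\<exists>x y. embeds [] A x B y \<and> productive t x \<and> productive t y \<and>
    ((n::nat) > 0 \<longrightarrow> visible t (x @ y)))"

lemma segment_refl: "segment t A 0 A"
  unfolding segment_def by (intro exI[of _ "[]"]) (auto simp: embeds_def)

lemma segment_trans:
  assumes "segment t A m B" "segment t B n D" shows "segment t A (m + n) D"
proof -
  from assms obtain x y x' y' where xy: "embeds [] A x B y" "embeds [] B x' D y'"
    "productive t (x @ x' @ y' @ y)" "m > 0 \<longrightarrow> visible t (x @ y)" "n > 0 \<longrightarrow> visible t (x' @ y')"
    by (auto simp: segment_def)
  have "embeds [] A (x @ x') D (y' @ y)"
    using embeds_trans[OF xy(1,2) expands_refl expands_refl] by simp
  then show ?thesis using xy unfolding segment_def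
    by (intro exI[of _ "x @ x'"] exI[of _ "y' @ y"]) auto
qed

lemma expands_middle:
  assumes "expands x \<sigma> p" "expands [NTer D] \<sigma> u" "expands y \<sigma> q"
  shows "expands (x @ NTer D # y) \<sigma> (p @ u @ q)"
  using expands_append[OF assms(1) expands_append[OF assms(2,3)]] by simp

lemma segment_Copy:
  assumes "Copy A \<beta> \<in> prods G" "selects t \<beta> m D" shows "segment t A m D"
proof -
  from assms obtain x y where xy: "\<beta> = x @ NTer D # y" "productive t x" "productive t y"
    "m > 0 \<longrightarrow> visible t (x @ y)" by (auto simp: selects_def)
  have "embeds [] A x D y" unfolding embeds_def
    using assms(1) xy(1) by (auto intro: expands_Copy expands_middle)
  then show ?thesis using xy unfolding segment_def by blast
qed

text \<open>A push and its matching pop enclose a segment one flag higher. The side words of that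
  segment are brought down through the flag by \<open>productive_expands\<close>, which keeps them
  visible.\<close>

lemma segment_nest:
  assumes push: "Push A B f \<in> prods G" and seg: "segment (lift [f] t) B k E"
    and pop: "Pop E f \<beta> \<in> prods G" and sel: "selects t \<beta> m D"
  shows "segment t A (m + k) D"
proof -
  from sel obtain x y where xy: "\<beta> = x @ NTer D # y" "productive t x" "productive t y"
    "m > 0 \<longrightarrow> visible t (x @ y)" by (auto simp: selects_def)
  from seg obtain x' y' where xy': "embeds [] B x' E y'" "productive (lift [f] t) x'"
    "productive (lift [f] t) y'" "k > 0 \<longrightarrow> visible (lift [f] t) (x' @ y')"
    by (auto simp: segment_def)
  obtain p q where p: "expands x' [f] p" "productive t p" "visible (lift [f] t) x' \<longrightarrow> visible t p"
    and q: "expands y' [f] q" "productive t q" "visible (lift [f] t) y' \<longrightarrow> visible t q"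
    using productive_expands[OF xy'(2)] productive_expands[OF xy'(3)] by auto
  have "embeds [f] A [] B []" using expands_Push[OF push] by (auto simp: embeds_def)
  from embeds_trans[OF this xy'(1) p(1) q(1)] have AE: "embeds [f] A p E q" by simp
  have "embeds [] A (p @ x) D (y @ q)" unfolding embeds_def
  proof (intro allI impI)
    fix \<rho> u p' q'
    assume "expands [NTer D] ([] @ \<rho>) u" "expands (p @ x) \<rho> p'" "expands (y @ q) \<rho> q'"
    then obtain p1 p2 q1 q2 where *: "p' = p1 @ p2" "expands p \<rho> p1" "expands x \<rho> p2"
      "q' = q1 @ q2" "expands y \<rho> q1" "expands q \<rho> q2" "expands [NTer D] \<rho> u"
      by (auto elim!: expands_append_split)
    have "expands [NTer E] ([f] @ \<rho>) (p2 @ u @ q1)"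
      using expands_Pop[OF pop] expands_middle[OF *(3,7,5)] xy(1) by simp
    then have "expands [NTer A] \<rho> (p1 @ (p2 @ u @ q1) @ q2)"
      using AE * unfolding embeds_def by blast
    then show "expands [NTer A] \<rho> (p' @ u @ q')" using * by simp
  qed
  then show ?thesis using xy xy'(4) p q unfolding segment_def
    by (intro exI[of _ "p @ x"] exI[of _ "y @ q"]) auto
qed

text \<open>The condition \<open>lift [] t = t\<close> says that \<open>t\<close> is saturated under
  derivations that pop nothing of the stack below. By \<open>lift_append\<close> every value of
  \<open>lift\<close> satisfies it.\<close>

lemma segment_productive:
  assumes "segment t A n B" "B \<in> fst t" "lift [] t = t" shows "A \<in> fst t"
proof -
  from assms(1) obtain x y where "embeds [] A x B y" "productive t x" "productive t y"
    by (auto simp: segment_def)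
  then show ?thesis
    using expands_productive[OF embeds_Nil_expands, of A x B y t] assms by auto
qed

text \<open>A branch of a derivation tree, read as a derivation of a one-letter context-free grammar that
  counts the nodes with a visible sibling. The state \<open>(t, A, Some D)\<close> is a piece of branch from \<open>A\<close>
  to \<open>D\<close> on the same stack of type \<open>t\<close> that never goes below it; \<open>(t, A, None)\<close> is a final piece
  of branch that never goes below the stack on which it starts.\<close>

fun run_stop :: "'n stype \<times> 'n \<times> 'n option \<Rightarrow> bool" where
  "run_stop (t, A, c) \<longleftrightarrow> c = Some A \<or> c = None \<and> A \<in> fst t"

text \<open>A push by a unary step is never popped again, which is possible only on a final piece;
  hence \<open>c = None\<close> there.\<close>

fun run_step :: "'n stype \<times> 'n \<times> 'n option \<Rightarrow> nat \<Rightarrow> 'n stype \<times> 'n \<times> 'n option \<Rightarrow> bool" where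
  "run_step (t, A, c) m (t', B, c') \<longleftrightarrow> c' = c \<and>
    ((\<exists>\<beta>. Copy A \<beta> \<in> prods G \<and> selects t \<beta> m B \<and> t' = t) \<or>
     (\<exists>f. Push A B f \<in> prods G \<and> c = None \<and> m = 0 \<and> t' = lift [f] t))"

text \<open>The binary rule of the triple construction for pushdown automata: the piece from
  \<open>B\<close> to \<open>E\<close> runs above the flag, and after the pop the branch goes on
  from \<open>D\<close> on the original stack.\<close>

fun run_nest :: "'n stype \<times> 'n \<times> 'n option \<Rightarrow> nat \<Rightarrow> 'n stype \<times> 'n \<times> 'n option
    \<Rightarrow> 'n stype \<times> 'n \<times> 'n option \<Rightarrow> bool" where
  "run_nest (t, A, c) m (t', B, c') (t'', D, c'') \<longleftrightarrow> t'' = t \<and> c'' = c \<and>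
    (\<exists>f E \<beta>. Push A B f \<in> prods G \<and> t' = lift [f] t \<and> c' = Some E \<and>
      Pop E f \<beta> \<in> prods G \<and> selects t \<beta> m D)"

abbreviation runs where "runs \<equiv> ugen run_stop run_step run_nest UNIV"

lemma runs_Some: "runs X k \<Longrightarrow> X = (t, A, Some D) \<Longrightarrow> segment t A k D"
proof (induction arbitrary: t A D rule: ugen.induct)
  case (leaf X)
  then show ?case by (auto intro: segment_refl)
next
  case (unary X m Y k)
  then show ?case by (cases Y) (auto intro!: segment_trans intro: segment_Copy)
next
  case (binary X m Y Z k l)
  obtain t1 B c1 D' where [simp]: "Y = (t1, B, c1)" "Z = (t, D', Some D)"
    using binary by (cases Y; cases Z) auto
  from binary obtain f E \<beta> where *: "Push A B f \<in> prods G" "t1 = lift [f] t" "c1 = Some E"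
    "Pop E f \<beta> \<in> prods G" "selects t \<beta> m D'" by auto
  have "segment t A (m + k) D'" using segment_nest[OF *(1) _ *(4,5)] binary.IH(1) * by simp
  then show ?case using binary.IH(2) by (auto intro: segment_trans)
qed

text \<open>The branch stops at a productive nonterminal, and productivity is passed back along it
  because all siblings are productive.\<close>

lemma runs_None: "runs X k \<Longrightarrow> X = (t, A, None) \<Longrightarrow> lift [] t = t \<Longrightarrow> A \<in> fst t"
proof (induction arbitrary: t A rule: ugen.induct)
  case (unary X m Y k)
  obtain t' B where Y: "Y = (t', B, None)" using unary by (cases Y) auto
  from unary.hyps Y unary.prems consider \<beta> where "Copy A \<beta> \<in> prods G" "selects t \<beta> m B" "t' = t"
    | f where "Push A B f \<in> prods G" "t' = lift [f] t" by auto
  then show ?case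
  proof cases
    case 1
    then show ?thesis using unary.IH Y unary.prems segment_productive segment_Copy by blast
  next
    case 2
    then have "B \<in> fst (lift [f] t)"
      using unary.IH[OF Y] lift_append[of "[]" "[f]" t] by simp
    then obtain v where "expands [NTer B] [f] v" "productive t v" by (auto simp: lift_def)
    then have "A \<in> fst (lift [] t)" using expands_Push[OF 2(1)] by (auto simp: lift_def)
    then show ?thesis using unary.prems by simp
  qed
next
  case (binary X m Y Z k l)
  obtain t1 B c1 D where [simp]: "Y = (t1, B, c1)" "Z = (t, D, None)"
    using binary by (cases Y; cases Z) auto
  from binary obtain f E \<beta> where *: "Push A B f \<in> prods G" "t1 = lift [f] t" "c1 = Some E"
    "Pop E f \<beta> \<in> prods G" "selects t \<beta> m D" by auto
  have "segment t A (m + k) D" using segment_nest[OF *(1) _ *(4,5)] runs_Some[OF binary(3)] * by simp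
  moreover have "D \<in> fst t" using binary.IH(2) binary.prems by simp
  ultimately show ?case by (rule segment_productive) (fact binary.prems(2))
qed auto

text \<open>In the case \<open>c = None\<close>, \<open>c' = Some D'\<close> nothing is claimed about \<open>n\<close>: a loop never passes
  from \<open>None\<close> to \<open>Some\<close>.\<close>

fun ctx :: "'n stype \<times> 'n \<times> 'n option \<Rightarrow> 'n stype \<times> 'n \<times> 'n option \<Rightarrow> nat \<Rightarrow> bool" where
  "ctx (t, A, c) (t', A', c') n \<longleftrightarrow>
    (\<exists>\<sigma> x y. t' = lift \<sigma> t \<and> embeds \<sigma> A x A' y \<and> productive t x \<and> productive t y \<and>
      (case c of
        None \<Rightarrow> (\<forall>D'. c' = Some D' \<longrightarrow> D' \<in> fst t') \<and> (c' = None \<and> n > 0 \<longrightarrow> visible t (x @ y))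
      | Some D \<Rightarrow> \<exists>D' x' y'. c' = Some D' \<and> expands [NTer D'] \<sigma> (x' @ NTer D # y') \<and>
          productive t x' \<and> productive t y' \<and> (n > 0 \<longrightarrow> visible t (x @ y @ x' @ y'))))"

section \<open>Contexts between states of the one-letter grammar\<close>

lemma ctx_segment:
  assumes "segment t A n B" "lift [] t = t"
  shows "ctx (t, A, c) (t, B, c) n"
proof -
  from assms obtain x y where xy: "embeds [] A x B y" "productive t x" "productive t y"
    "n > 0 \<longrightarrow> visible t (x @ y)" by (auto simp: segment_def)
  show ?thesis
  proof (cases c)
    case None
    then show ?thesis unfolding None ctx.simps option.case
      using xy assms(2) by (intro exI[of _ "[]"] exI[of _ x] exI[of _ y]) auto
  next
    case (Some D)
    have "expands [NTer D] [] ([] @ NTer D # [])" by (simp add: expands_refl)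
    then show ?thesis unfolding Some ctx.simps option.case
      using xy assms(2)
      by (intro exI[of _ "[]"] exI[of _ x] exI[of _ y] conjI exI[of _ D]) auto
  qed
qed

lemma ctx_R1:
  assumes "lift [] t = t" "run_step (t, A, c) m Y" shows "ctx (t, A, c) Y m"
proof -
  obtain t' B where Y: "Y = (t', B, c)" using assms by (cases Y) auto
  from assms(2) Y consider \<beta> where "Copy A \<beta> \<in> prods G" "selects t \<beta> m B" "t' = t"
    | f where "Push A B f \<in> prods G" "t' = lift [f] t" "c = None" "m = 0" by auto
  then show ?thesis
  proof cases
    case 1
    then show ?thesis using ctx_segment segment_Copy assms Y by blast
  next
    case 2
    have "embeds [f] A [] B []" using expands_Push[OF 2(1)] by (auto simp: embeds_def)
    then show ?thesis unfolding Y 2(3) ctx.simps option.case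
      using 2 by (intro exI[of _ "[f]"] exI[of _ "[]"]) auto
  qed
qed

text \<open>Entering the piece above the flag lengthens the stack by \<open>f\<close>. The way back
  from \<open>E\<close> consists of the pop and the run of \<open>Z\<close>, whose side words
  account for the weight \<open>m + k\<close>. For \<open>c = None\<close> only the productivity of
  \<open>E\<close> is recorded.\<close>

lemma ctx_R2l:
  assumes cl: "lift [] t = t" and "run_nest (t, A, c) m Y Z" "runs Z k" shows "ctx (t, A, c) Y (m + k)"
proof -
  obtain t1 B c1 D where Y: "Y = (t1, B, c1)" and Z: "Z = (t, D, c)"
    using assms by (cases Y; cases Z) auto
  from assms(2) Y Z obtain f E \<beta> where *: "Push A B f \<in> prods G" "t1 = lift [f] t" "c1 = Some E"
    "Pop E f \<beta> \<in> prods G" "selects t \<beta> m D" by auto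
  from *(5) obtain x y where xy: "\<beta> = x @ NTer D # y" "productive t x" "productive t y"
    "m > 0 \<longrightarrow> visible t (x @ y)" by (auto simp: selects_def)
  have emb: "embeds [f] A [] B []" using expands_Push[OF *(1)] by (auto simp: embeds_def)
  show ?thesis
  proof (cases c)
    case None
    then have "D \<in> fst t" using runs_None[OF assms(3)] Z cl by auto
    then have "productive t \<beta>" using xy by simp
    moreover have "expands [NTer E] [f] \<beta>" using expands_Pop[OF *(4) expands_refl] .
    ultimately have "E \<in> fst (lift [f] t)" by (auto simp: lift_def)
    then show ?thesis unfolding Y None ctx.simps option.case
      using emb * by (intro exI[of _ "[f]"] exI[of _ "[]"]) auto
  next
    case (Some C)
    then obtain p q where pq: "embeds [] D p C q" "productive t p" "productive t q"
      "k > 0 \<longrightarrow> visible t (p @ q)" using runs_Some[OF assms(3)] Z by (auto simp: segment_def)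
    have "expands \<beta> [] (x @ (p @ NTer C # q) @ y)"
      unfolding xy(1) by (intro expands_middle expands_refl embeds_Nil_expands pq)
    then have "expands [NTer E] [f] ((x @ p) @ NTer C # (q @ y))" using expands_Pop[OF *(4)] by simp
    then show ?thesis unfolding Some ctx.simps option.case Y
      using xy pq emb *
      by (intro exI[of _ "[f]"] exI[of _ "[]"] conjI exI[of _ E] exI[of _ "x @ p"] exI[of _ "q @ y"]) auto
  qed
qed

text \<open>Passing over the whole nested piece returns to the same stack, so it is a single
  segment.\<close>

lemma ctx_R2r:
  assumes cl: "lift [] t = t" and "run_nest (t, A, c) m Y Z" "runs Y k" shows "ctx (t, A, c) Z (m + k)"
proof -
  obtain t1 B c1 D where Y: "Y = (t1, B, c1)" and Z: "Z = (t, D, c)"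
    using assms by (cases Y; cases Z) auto
  from assms(2) Y Z obtain f E \<beta> where *: "Push A B f \<in> prods G" "t1 = lift [f] t" "c1 = Some E"
    "Pop E f \<beta> \<in> prods G" "selects t \<beta> m D" by auto
  have "segment t A (m + k) D" using segment_nest[OF *(1) _ *(4,5)] runs_Some[OF assms(3)] Y * by simp
  then show ?thesis unfolding Z using cl by (intro ctx_segment) auto
qed

lemma ctx_trans:
  assumes "ctx X Y a" "ctx Y Z b" shows "ctx X Z (a + b)"
proof -
  obtain t A c t' A' c' t'' A'' c'' where X: "X = (t, A, c)" and Y: "Y = (t', A', c')"
    and Z: "Z = (t'', A'', c'')" by (cases X; cases Y; cases Z) auto
  from assms(1) obtain \<sigma> x y where 1: "t' = lift \<sigma> t" "embeds \<sigma> A x A' y" "productive t x"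
    "productive t y" and dn1:
      "case c of
        None \<Rightarrow> (\<forall>D'. c' = Some D' \<longrightarrow> D' \<in> fst t') \<and> (c' = None \<and> a > 0 \<longrightarrow> visible t (x @ y))
      | Some D \<Rightarrow> \<exists>D' x' y'. c' = Some D' \<and> expands [NTer D'] \<sigma> (x' @ NTer D # y') \<and>
          productive t x' \<and> productive t y' \<and> (a > 0 \<longrightarrow> visible t (x @ y @ x' @ y'))"
    unfolding X Y ctx.simps by blast
  from assms(2) obtain \<sigma>' x2 y2 where 2: "t'' = lift \<sigma>' t'" "embeds \<sigma>' A' x2 A'' y2" "productive t' x2"
    "productive t' y2" and dn2:
      "case c' of
        None \<Rightarrow> (\<forall>D'. c'' = Some D' \<longrightarrow> D' \<in> fst t'') \<and> (c'' = None \<and> b > 0 \<longrightarrow> visible t' (x2 @ y2))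
      | Some D \<Rightarrow> \<exists>D' x' y'. c'' = Some D' \<and> expands [NTer D'] \<sigma>' (x' @ NTer D # y') \<and>
          productive t' x' \<and> productive t' y' \<and> (b > 0 \<longrightarrow> visible t' (x2 @ y2 @ x' @ y'))"
    unfolding Y Z ctx.simps by blast
  \<comment> \<open>Side words of the second context live above \<sigma> and have to be brought down
    to the stack of type \<open>t\<close>.\<close>
  have red: "\<exists>p. expands v \<sigma> p \<and> productive t p \<and> (visible t' v \<longrightarrow> visible t p)"
    if "productive t' v" for v using productive_expands that 1(1) by blast
  obtain p q where p: "expands x2 \<sigma> p" "productive t p" "visible t' x2 \<longrightarrow> visible t p"
    and q: "expands y2 \<sigma> q" "productive t q" "visible t' y2 \<longrightarrow> visible t q"
    using red[OF 2(3)] red[OF 2(4)] by blast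
  have t'': "t'' = lift (\<sigma>' @ \<sigma>) t" using 1 2 by (simp add: lift_append)
  have emb: "embeds (\<sigma>' @ \<sigma>) A (x @ p) A'' (q @ y)" by (rule embeds_trans[OF 1(2) 2(2) p(1) q(1)])
  show ?thesis
  proof (cases c)
    case None
    \<comment> \<open>If \<open>c'\<close> is \<open>Some D'\<close>, then \<open>D\<close> leads
      back to the productive \<open>D'\<close>; otherwise the second context already gives the
      claim.\<close>
    have "D \<in> fst t''" if D: "c'' = Some D" for D
    proof (cases c')
      case (Some D')
      then obtain x' y' where "expands [NTer D] \<sigma>' (x' @ NTer D' # y')"
          "productive t' x'" "productive t' y'" "D' \<in> fst t'"
        using dn1 dn2 None D by auto
      then have "expands [NTer D] \<sigma>' (x' @ NTer D' # y')" "productive t' (x' @ NTer D' # y')" by auto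
      then show ?thesis unfolding 2(1) lift_def by auto
    qed (use dn2 that in auto)
    \<comment> \<open>Here \<open>c'\<close> is \<open>None\<close> too, because a context starting
      from \<open>Some\<close> cannot end in \<open>None\<close>.\<close>
    moreover have "visible t ((x @ p) @ q @ y)" if "c'' = None" "a + b > 0"
      using that dn1 dn2 None p q by (cases c') auto
    ultimately show ?thesis unfolding X Z None ctx.simps option.case
      using t'' emb 1 p q by (intro exI[of _ "\<sigma>' @ \<sigma>"] exI[of _ "x @ p"] exI[of _ "q @ y"]) auto
  next
    case (Some D)
    then obtain D' x1' y1' where 3: "c' = Some D'" "expands [NTer D'] \<sigma> (x1' @ NTer D # y1')"
      "productive t x1'" "productive t y1'" "a > 0 \<longrightarrow> visible t (x @ y @ x1' @ y1')"
      using dn1 by auto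
    then obtain D'' x2' y2' where 4: "c'' = Some D''" "expands [NTer D''] \<sigma>' (x2' @ NTer D' # y2')"
      "productive t' x2'" "productive t' y2'" "b > 0 \<longrightarrow> visible t' (x2 @ y2 @ x2' @ y2')"
      using dn2 by auto
    obtain p' q' where p': "expands x2' \<sigma> p'" "productive t p'" "visible t' x2' \<longrightarrow> visible t p'"
      and q': "expands y2' \<sigma> q'" "productive t q'" "visible t' y2' \<longrightarrow> visible t q'"
      using red[OF 4(3)] red[OF 4(4)] by blast
    \<comment> \<open>The ways back compose in the opposite order: first \<sigma>' is removed,
      reaching \<open>D'\<close>, then \<sigma>, reaching \<open>D\<close>.\<close>
    have "expands [NTer D''] (\<sigma>' @ \<sigma>) (p' @ (x1' @ NTer D # y1') @ q')"
      by (rule expands_trans[OF 4(2)]) (rule expands_middle[OF p'(1) 3(2) q'(1)])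
    then have "expands [NTer D''] (\<sigma>' @ \<sigma>) ((p' @ x1') @ NTer D # (y1' @ q'))" by simp
    moreover have "visible t ((x @ p) @ (q @ y) @ (p' @ x1') @ y1' @ q')" if "a + b > 0"
      using that 3(5) 4(5) p(3) q(3) p'(3) q'(3) by (cases "a > 0") auto
    ultimately show ?thesis unfolding X Z Some ctx.simps option.case
      using t'' emb 1(3,4) 3(3,4) 4(1) p(2) q(2) p'(2) q'(2)
      by (intro exI[of _ "\<sigma>' @ \<sigma>"] exI[of _ "x @ p"] exI[of _ "q @ y"] conjI
          exI[of _ D''] exI[of _ "p' @ x1'"] exI[of _ "y1' @ q'"]) simp_all
  qed
qed

section \<open>Heavy branches\<close>

definition stack_type :: "'f list \<Rightarrow> 'n stype" where
  "stack_type \<tau> = lift \<tau> ({}, {})"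

lemma stack_type_append: "stack_type (\<sigma> @ \<tau>) = lift \<sigma> (stack_type \<tau>)"
  by (simp add: stack_type_def lift_append)

lemma stack_type_Cons: "stack_type (f # \<tau>) = lift [f] (stack_type \<tau>)"
  using stack_type_append[of "[f]" \<tau>] by simp

lemma expands_stack_type:
  assumes "expands x \<tau> (map Ter w)"
  shows "productive (stack_type \<tau>) x" "w \<noteq> [] \<Longrightarrow> visible (stack_type \<tau>) x"
  using expands_productive[OF assms, of "({}, {})"] by (auto simp: stack_type_def)

text \<open>A branch on an actual stack, decomposed at the moments when it first pops each flag of
  the initial stack. On the empty stack only \<open>stay\<close> remains, which is a single
  run.\<close>

inductive path :: "'n \<Rightarrow> 'f list \<Rightarrow> nat \<Rightarrow> bool" where
  stay: "runs (stack_type \<tau>, A, None) k \<Longrightarrow> path A \<tau> k"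
| drop: "runs (stack_type (f # \<tau>), A, Some E) k \<Longrightarrow> Pop E f \<beta> \<in> prods G \<Longrightarrow> selects (stack_type \<tau>) \<beta> m D
    \<Longrightarrow> path D \<tau> l \<Longrightarrow> path A (f # \<tau>) (k + m + l)"

lemma path_stop: "A \<in> fst (stack_type \<tau>) \<Longrightarrow> path A \<tau> 0"
  by (intro stay ugen.leaf) auto

lemma path_Copy:
  assumes "path B \<tau> k" "Copy A \<beta> \<in> prods G" "selects (stack_type \<tau>) \<beta> m B"
  shows "path A \<tau> (m + k)"
  using assms(1)
proof cases
  case stay
  then show ?thesis using assms by (intro path.stay ugen.unary[of _ _ _ _ "(stack_type \<tau>, B, None)"]) auto
next
  case (drop f \<tau>' E k' \<beta>' m' D l)
  then have "runs (stack_type \<tau>, A, Some E) (m + k')"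
    using assms by (intro ugen.unary[of _ _ _ _ "(stack_type \<tau>, B, Some E)"]) auto
  from path.drop[OF this[unfolded drop(1)] drop(4-6)] show ?thesis using drop(1,2) by (simp add: add.assoc)
qed

text \<open>If the branch later pops \<open>f\<close>, this pop matches the new push and the two
  form a nest; otherwise the push is an unmatched unary step.\<close>

lemma path_Push:
  assumes "path B (f # \<tau>) k" "Push A B f \<in> prods G"
  shows "path A \<tau> k"
  using assms(1)
proof cases
  case stay
  then have "runs (stack_type \<tau>, A, None) (0 + k)"
    using assms by (intro ugen.unary[of _ _ _ _ "(stack_type (f # \<tau>), B, None)"]) (auto simp: stack_type_Cons)
  then show ?thesis by (auto intro: path.stay)
next
  case (drop E k' \<beta> m D l)
  have run_nest: "run_nest (stack_type \<tau>, A, c) m (stack_type (f # \<tau>), B, Some E) (stack_type \<tau>, D, c)" for c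
    using drop assms by (auto simp: stack_type_Cons)
  \<comment> \<open>The target \<open>c\<close> stays open because the continuation from
    \<open>D\<close> may be final or may itself drop below \<tau>.\<close>
  have nest: "runs (stack_type \<tau>, A, c) (m + k' + l')" if "runs (stack_type \<tau>, D, c) l'" for c l'
    using UNIV_I run_nest[of c] drop(2) that by (rule ugen.binary)
  from drop(5) show ?thesis
  proof cases
    case stay
    then show ?thesis using nest[of None l] drop(1) by (auto intro: path.stay simp: add.commute)
  next
    case (drop f' \<tau>' E' k1 \<beta>' m' D' l')
    from path.drop[OF nest[unfolded drop(1), OF drop(3)] drop(4-6)] show ?thesis
      using drop(1,2) \<open>k = k' + m + l\<close> by (simp add: ac_simps)
  qed
qed

lemma path_Pop:
  assumes "path D \<tau> k" "Pop A f \<beta> \<in> prods G" "selects (stack_type \<tau>) \<beta> m D"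
  shows "path A (f # \<tau>) (m + k)"
proof -
  have "runs (stack_type (f # \<tau>), A, Some A) 0" by (intro ugen.leaf) auto
  from path.drop[OF this assms(2,3,1)] show ?thesis by simp
qed

lemma path_Nil: "path A [] k \<Longrightarrow> runs (stack_type [], A, None) k"
  by (erule path.cases) auto

text \<open>Following the child with the longest yield, the length of the yield shrinks only at nodes with a
  visible sibling, and there at most by the factor \<open>c\<close>.\<close>

definition piece :: "nat \<Rightarrow> 'f list \<Rightarrow> ('n, 't) gsym \<Rightarrow> 't list \<Rightarrow> bool" where
  "piece c \<sigma> s u \<longleftrightarrow> expands [s] \<sigma> (map Ter u) \<and>
    (case s of Ter a \<Rightarrow> length u \<le> 1 | NTer B \<Rightarrow> \<exists>k. path B \<sigma> k \<and> length u \<le> c ^ (k + 1))"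

lemma pieces_expand: "list_all2 (piece c \<sigma>) \<alpha> ws \<Longrightarrow> expands \<alpha> \<sigma> (map Ter (concat ws))"
proof (induction rule: list_all2_induct)
  case (Cons s \<alpha> u ws)
  then show ?case using expands_append[of "[s]" \<sigma> "map Ter u"] by (simp add: piece_def)
qed (auto intro: expands.Nil)

lemma length_concat_le: "(\<And>u. u \<in> set ws \<Longrightarrow> length u \<le> M) \<Longrightarrow> length (concat ws) \<le> length ws * M"
  by (induction ws) (auto simp: add_mono)

text \<open>A longest piece of length above 1 belongs to a nonterminal \<open>D\<close>. If all
  other pieces are empty, no length is lost and \<open>m = 0\<close>; otherwise a sibling is
  visible, and the at most \<open>c\<close> pieces cost one more factor \<open>c\<close>, paid by
  \<open>m = 1\<close>.\<close>

lemma heavy_piece: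
  assumes ps: "list_all2 (piece c \<sigma>) \<beta> ws" and len: "length \<beta> \<le> c"
  shows "length (concat ws) \<le> c \<or>
    (\<exists>D m k. selects (stack_type \<sigma>) \<beta> m D \<and> path D \<sigma> k \<and> length (concat ws) \<le> c ^ (m + k + 1))"
proof (cases "\<forall>u\<in>set ws. length u \<le> 1")
  case True
  then have "length (concat ws) \<le> length ws * 1" by (intro length_concat_le) auto
  then show ?thesis using len list_all2_lengthD[OF ps] by simp
next
  case False
  then have ne: "set ws \<noteq> {}" by auto
  define M where "M = Max (length ` set ws)"
  have le: "length u \<le> M" if "u \<in> set ws" for u using that by (simp add: M_def)
  have "M \<in> length ` set ws" unfolding M_def using ne by (intro Max_in) auto
  then obtain u where u: "u \<in> set ws" "length u = M" by auto
  then have "M > 1" using False le by fastforce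
  from u obtain ws1 ws2 where ws: "ws = ws1 @ u # ws2" by (meson split_list)
  from ps obtain x s y where \<beta>: "\<beta> = x @ s # y" and x: "list_all2 (piece c \<sigma>) x ws1"
    and s: "piece c \<sigma> s u" and y: "list_all2 (piece c \<sigma>) y ws2"
    by (auto simp: ws list_all2_append2 list_all2_Cons2)
  obtain D where D: "s = NTer D" using s u \<open>M > 1\<close> by (cases s) (auto simp: piece_def)
  then obtain k where k: "path D \<sigma> k" "M \<le> c ^ (k + 1)" using s u by (auto simp: piece_def)
  note xv = expands_stack_type[OF pieces_expand[OF x]] and yv = expands_stack_type[OF pieces_expand[OF y]]
  show ?thesis
  proof (cases "concat ws1 @ concat ws2 = []")
    case True
    then have "concat ws1 = []" "concat ws2 = []" unfolding append_is_Nil_conv by blast+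
    then have "concat ws = u" by (simp only: ws concat_append concat.simps append_Nil append_Nil2)
    then have "length (concat ws) \<le> c ^ (0 + k + 1)" using k u by simp
    moreover have "selects (stack_type \<sigma>) \<beta> 0 D" using \<beta> D xv yv by (auto simp: selects_def)
    ultimately show ?thesis using k by blast
  next
    case False
    have "length (concat ws) \<le> length ws * M" using le by (rule length_concat_le)
    also have "\<dots> \<le> c * c ^ (k + 1)"
      using len list_all2_lengthD[OF ps] k by (intro mult_mono) auto
    finally have "length (concat ws) \<le> c ^ (1 + k + 1)" by simp
    moreover have "selects (stack_type \<sigma>) \<beta> 1 D"
      unfolding selects_def using \<beta> D xv yv False by (intro conjI exI[of _ x] exI[of _ y]) auto
    ultimately show ?thesis using k by blast
  qed
qed

lemma expands_pieces:
  assumes c: "\<And>A \<beta>. Copy A \<beta> \<in> prods G \<Longrightarrow> length \<beta> \<le> c"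
      "\<And>A f \<beta>. Pop A f \<beta> \<in> prods G \<Longrightarrow> length \<beta> \<le> c"
  shows "expands \<alpha> \<sigma> v \<Longrightarrow> v = map Ter w \<Longrightarrow> \<exists>ws. w = concat ws \<and> list_all2 (piece c \<sigma>) \<alpha> ws"
proof (induction arbitrary: w rule: expands.induct)
  case (Nil \<sigma>)
  then show ?case by (auto intro: exI[of _ "[]"])
next
  case (Ter \<alpha> \<sigma> v a)
  then obtain w' where w': "w = a # w'" "v = map Ter w'" by (cases w) auto
  then obtain ws where "w' = concat ws" "list_all2 (piece c \<sigma>) \<alpha> ws" using Ter by blast
  moreover have "piece c \<sigma> (Ter a) [a]" by (auto simp: piece_def intro: expands.intros)
  ultimately show ?case using w' by (intro exI[of _ "[a] # ws"]) auto
next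
  case (Base \<alpha> v B)
  then show ?case by (cases w) auto
next
  case (Copy B \<beta> \<sigma> u \<alpha> v)
  then obtain w1 w2 where w: "w = w1 @ w2" "u = map Ter w1" "v = map Ter w2"
    by (auto simp: append_eq_map_conv)
  then obtain ws1 ws2 where ws: "w1 = concat ws1" "list_all2 (piece c \<sigma>) \<beta> ws1"
    "w2 = concat ws2" "list_all2 (piece c \<sigma>) \<alpha> ws2" using Copy.IH by metis
  have ex: "expands [NTer B] \<sigma> (map Ter w1)" using expands_Copy Copy w by blast
  have "\<exists>k. path B \<sigma> k \<and> length w1 \<le> c ^ (k + 1)"
    using heavy_piece[OF ws(2) c(1)[OF Copy(1)]]
  proof (elim disjE exE conjE)
    \<comment> \<open>A yield this short lets the branch stop at \<open>B\<close>; the exponent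
      \<open>k + 1\<close> leaves room for it at \<open>k = 0\<close>.\<close>
    assume "length (concat ws1) \<le> c"
    then show ?thesis using path_stop expands_stack_type(1)[OF ex] ws by (intro exI[of _ 0]) auto
  next
    fix D m k assume "selects (stack_type \<sigma>) \<beta> m D" "path D \<sigma> k" "length (concat ws1) \<le> c ^ (m + k + 1)"
    then show ?thesis using path_Copy[OF _ Copy(1)] ws(1) by blast
  qed
  then have "piece c \<sigma> (NTer B) w1" using ex by (simp add: piece_def)
  then show ?case using w ws by (intro exI[of _ "w1 # ws2"]) auto
next
  case (Push B D f \<sigma> u \<alpha> v)
  then obtain w1 w2 where w: "w = w1 @ w2" "u = map Ter w1" "v = map Ter w2"
    by (auto simp: append_eq_map_conv)
  then obtain ws1 ws2 where ws: "w1 = concat ws1" "list_all2 (piece c (f # \<sigma>)) [NTer D] ws1"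
    "w2 = concat ws2" "list_all2 (piece c \<sigma>) \<alpha> ws2" using Push.IH by metis
  have ex: "expands [NTer B] \<sigma> (map Ter w1)" using expands_Push Push w by blast
  have "piece c (f # \<sigma>) (NTer D) w1" using ws(1,2) by (auto simp: list_all2_Cons1)
  then have "\<exists>k. path D (f # \<sigma>) k \<and> length w1 \<le> c ^ (k + 1)" by (simp add: piece_def)
  then have "\<exists>k. path B \<sigma> k \<and> length w1 \<le> c ^ (k + 1)" using path_Push[OF _ Push(1)] by blast
  then have "piece c \<sigma> (NTer B) w1" using ex by (simp add: piece_def)
  then show ?case using w ws by (intro exI[of _ "w1 # ws2"]) auto
next
  case (Pop B f \<beta> \<sigma> u \<alpha> v)
  then obtain w1 w2 where w: "w = w1 @ w2" "u = map Ter w1" "v = map Ter w2"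
    by (auto simp: append_eq_map_conv)
  then obtain ws1 ws2 where ws: "w1 = concat ws1" "list_all2 (piece c \<sigma>) \<beta> ws1"
    "w2 = concat ws2" "list_all2 (piece c (f # \<sigma>)) \<alpha> ws2" using Pop.IH by metis
  have ex: "expands [NTer B] (f # \<sigma>) (map Ter w1)" using expands_Pop Pop w by blast
  have "\<exists>k. path B (f # \<sigma>) k \<and> length w1 \<le> c ^ (k + 1)"
    using heavy_piece[OF ws(2) c(2)[OF Pop(1)]]
  proof (elim disjE exE conjE)
    assume "length (concat ws1) \<le> c"
    then show ?thesis using path_stop expands_stack_type(1)[OF ex] ws by (intro exI[of _ 0]) auto
  next
    fix D m k assume "selects (stack_type \<sigma>) \<beta> m D" "path D \<sigma> k" "length (concat ws1) \<le> c ^ (m + k + 1)"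
    then show ?thesis using path_Pop[OF _ Pop(1)] ws(1) by blast
  qed
  then have "piece c (f # \<sigma>) (NTer B) w1" using ex by (simp add: piece_def)
  then show ?case using w ws by (intro exI[of _ "w1 # ws2"]) auto
qed

section \<open>Unbounded weights and the existence of a pump\<close>

lemma rhs_bound:
  obtains c where "c \<ge> 1" "\<And>A \<beta>. Copy A \<beta> \<in> prods G \<Longrightarrow> length \<beta> \<le> c"
    "\<And>A f \<beta>. Pop A f \<beta> \<in> prods G \<Longrightarrow> length \<beta> \<le> c"
proof -
  define len :: "('n, 't, 'f) iprod \<Rightarrow> nat" where
    "len p = (case p of Copy A \<beta> \<Rightarrow> length \<beta> | Push A B f \<Rightarrow> 0 | Pop A f \<beta> \<Rightarrow> length \<beta>)" for p
  have "finite (prods G)" using wf by (simp add: wf_igrammar_def)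
  \<comment> \<open>The successor makes the bound positive, as monotonicity of the powers of
    \<open>c\<close> requires.\<close>
  then have "len p \<le> Suc (Max (len ` prods G))" if "p \<in> prods G" for p
    using that by (simp add: le_SucI)
  from this[of "Copy _ _"] this[of "Pop _ _ _"] show ?thesis
    by (intro that[of "Suc (Max (len ` prods G))"]) (auto simp: len_def)
qed

text \<open>Only finitely many words have length at most \<open>c ^ n\<close>. A longer word has a
  heavy branch of weight at least \<open>n\<close>, and this branch starts on the empty
  stack.\<close>

lemma runs_unbounded:
  assumes "infinite (ilang G)"
  shows "\<exists>k\<ge>n. runs (stack_type [], start G, None) k"
proof -
  obtain c where c: "c \<ge> 1" "\<And>A \<beta>. Copy A \<beta> \<in> prods G \<Longrightarrow> length \<beta> \<le> c"
    "\<And>A f \<beta>. Pop A f \<beta> \<in> prods G \<Longrightarrow> length \<beta> \<le> c" by (rule rhs_bound) blast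
  have "finite {w. set w \<subseteq> terms G \<and> length w \<le> c ^ n}"
    using wf by (intro finite_lists_length_le) (simp add: wf_igrammar_def)
  then have "\<not> ilang G \<subseteq> {w. set w \<subseteq> terms G \<and> length w \<le> c ^ n}"
    using assms finite_subset by blast
  then obtain w where "w \<in> ilang G" "\<not> (set w \<subseteq> terms G \<and> length w \<le> c ^ n)" by blast
  then have w: "w \<in> ilang G" "length w > c ^ n" by (auto simp: ilang_def)
  from w(1) have "expands [NTer (start G)] [] (map Ter w)" by (simp add: ilang_iff)
  then have "\<exists>ws. w = concat ws \<and> list_all2 (piece c []) [NTer (start G)] ws"
    by (rule expands_pieces[OF _ _ _ refl, rotated 2]) (erule c(2) | erule c(3))+
  then obtain ws where ws: "w = concat ws" "list_all2 (piece c []) [NTer (start G)] ws"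
    by blast
  then have "piece c [] (NTer (start G)) w" by (auto simp: list_all2_Cons1)
  then obtain k where k: "path (start G) [] k" "length w \<le> c ^ (k + 1)"
    by (auto simp: piece_def)
  have "n < k + 1"
  proof (rule ccontr)
    assume "\<not> n < k + 1"
    then have "c ^ (k + 1) \<le> c ^ n" using c(1) by (intro power_increasing) auto
    then show False using k w by simp
  qed
  then show ?thesis using path_Nil[OF k(1)] by (intro exI[of _ k]) auto
qed

lemma pump_exists:
  assumes "infinite (ilang G)"
  obtains X a b k where "ctx (stack_type [], start G, None) X a" "ctx X X b" "b > 0" "runs X k"
proof -
  let ?N = "nonterms G"
  \<comment> \<open>Finiteness comes from the finitely many types over \<open>nonterms G\<close>;
    saturation of \<open>t\<close> is built in because the lemmas on \<open>ctx\<close> need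
    it.\<close>
  define F :: "('n stype \<times> 'n \<times> 'n option) set" where
    "F = {(t, A, c). lift [] t = t \<and> fst t \<subseteq> ?N \<and> snd t \<subseteq> ?N \<and> A \<in> ?N \<and> set_option c \<subseteq> ?N}"
  have F_iff: "(t, A, c) \<in> F \<longleftrightarrow>
    lift [] t = t \<and> fst t \<subseteq> ?N \<and> snd t \<subseteq> ?N \<and> A \<in> ?N \<and> set_option c \<subseteq> ?N" for t A c
    by (simp add: F_def)
  have finN: "finite ?N" using wf by (simp add: wf_igrammar_def)
  have "F \<subseteq> (Pow ?N \<times> Pow ?N) \<times> ?N \<times> insert None (Some ` ?N)"
  proof
    fix X assume "X \<in> F"
    then show "X \<in> (Pow ?N \<times> Pow ?N) \<times> ?N \<times> insert None (Some ` ?N)"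
      by (cases X; cases "snd (snd X)") (auto simp: F_def)
  qed
  then have fin: "finite F" by (rule finite_subset) (use finN in auto)
  have closed: "lift [] (lift \<sigma> t) = lift \<sigma> t" for \<sigma> t using lift_append[of "[]" \<sigma> t] by simp
  have X0: "(stack_type [], start G, None) \<in> F"
    using wf closed lift_subset[of "({}, {})" "[]"]
    by (auto simp: F_iff stack_type_def wf_igrammar_def)
  have sel: "selects t \<beta> m D \<Longrightarrow> rhs_ok G \<beta> \<Longrightarrow> D \<in> ?N \<and> m \<le> 1" for t \<beta> m D
    by (auto simp: selects_def)
  have lift_F: "lift [] (lift [f] t) = lift [f] t \<and> fst (lift [f] t) \<subseteq> ?N \<and> snd (lift [f] t) \<subseteq> ?N"
    if "fst t \<subseteq> ?N" for f t using closed lift_subset[OF that] by blast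
  have run_step: "Y \<in> F \<and> m \<le> 1" if "X \<in> F" "run_step X m Y" for X m Y
  proof -
    obtain t A c t' B c' where XY: "X = (t, A, c)" "Y = (t', B, c')" by (cases X; cases Y) auto
    from that(2) consider \<beta> where "Copy A \<beta> \<in> prods G" "selects t \<beta> m B" "t' = t" "c' = c"
      | f where "Push A B f \<in> prods G" "m = 0" "t' = lift [f] t" "c' = c"
      unfolding XY run_step.simps by blast
    then show ?thesis
    proof cases
      case 1
      then show ?thesis using that(1) sel[OF 1(2)] prods_ok(1)[OF 1(1)] unfolding XY F_iff by simp
    next
      case 2
      then show ?thesis using that(1) lift_F[of t f] prods_ok(2)[OF 2(1)] unfolding XY F_iff by simp
    qed
  qed
  have run_nest: "Y \<in> F \<and> Z \<in> F \<and> m \<le> 1" if "X \<in> F" "run_nest X m Y Z" for X m Y Z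
  proof -
    obtain t A c t1 B c1 t2 D c2 where XY: "X = (t, A, c)" "Y = (t1, B, c1)" "Z = (t2, D, c2)"
      by (cases X; cases Y; cases Z) auto
    from that(2) obtain f E \<beta> where *: "t2 = t" "c2 = c" "Push A B f \<in> prods G" "t1 = lift [f] t"
      "c1 = Some E" "Pop E f \<beta> \<in> prods G" "selects t \<beta> m D" unfolding XY run_nest.simps by blast
    then show ?thesis
      using that(1) lift_F[of t f] sel[of t \<beta> m D] prods_ok(2)[OF *(3)] prods_ok(3)[OF *(6)]
      unfolding XY F_iff by simp
  qed
  have "\<exists>X a b k. X \<in> F \<and> ctx (stack_type [], start G, None) X a \<and> ctx X X b \<and> b > 0 \<and> runs X k"
  proof (rule unary_cfg_pumping[OF fin X0])
    fix X assume "X \<in> F"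
    then obtain t A c where "X = (t, A, c)" "lift [] t = t" by (cases X) (auto simp: F_iff)
    then show "ctx X X 0" using ctx_segment[OF segment_refl] by blast
  next
    fix n show "\<exists>k\<ge>n. runs (stack_type [], start G, None) k" by (rule runs_unbounded[OF assms])
  next
    fix X Y Z m assume "X \<in> F"
    then obtain t A c where X: "X = (t, A, c)" "lift [] t = t" by (cases X) (auto simp: F_iff)
    show "run_step X m Y \<Longrightarrow> ctx X Y m" using ctx_R1 X by blast
    show "run_nest X m Y Z \<Longrightarrow> runs Z k \<Longrightarrow> ctx X Y (m + k)" for k using ctx_R2l X by blast
    show "run_nest X m Y Z \<Longrightarrow> runs Y k \<Longrightarrow> ctx X Z (m + k)" for k using ctx_R2r X by blast
  qed (erule (1) run_step | erule (1) run_nest | erule (1) ctx_trans)+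
  then show ?thesis using that by blast
qed

section \<open>The pumped D0L system\<close>

text \<open>The loop with its states removed. The word \<open>core\<close> stands where the repeated
  upward loop ends: it is \<open>[NTer A]\<close> if the branch never returns, and otherwise
  contains the \<open>D\<close> on which the downward loop acts. The words \<open>p\<close> and
  \<open>q\<close> come from the context leading from the start symbol to the loop.\<close>

lemma pump_data:
  assumes "infinite (ilang G)"
  obtains \<sigma>0 \<sigma> A x y p q core where
    "lift \<sigma> (stack_type \<sigma>0) = stack_type \<sigma>0"
    "\<And>u. expands [NTer A] \<sigma>0 (map Ter u) \<Longrightarrow> p @ u @ q \<in> ilang G"
    "embeds \<sigma> A x A y" "productive (stack_type \<sigma>0) x" "productive (stack_type \<sigma>0) y" "productive (stack_type \<sigma>0) core"
    "\<And>\<rho> u. expands core \<rho> u \<Longrightarrow> expands [NTer A] \<rho> u"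
    "visible (stack_type \<sigma>0) (x @ y) \<or> (\<exists>D x' y'. NTer D \<in> set core \<and>
      expands [NTer D] \<sigma> (x' @ NTer D # y') \<and> productive (stack_type \<sigma>0) (x' @ y') \<and> visible (stack_type \<sigma>0) (x' @ y'))"
proof -
  from pump_exists[OF assms] obtain X a b k where
    X: "ctx (stack_type [], start G, None) X a" "ctx X X b" "b > 0" "runs X k" by blast
  obtain t A c where X_eq: "X = (t, A, c)" by (cases X) auto
  from X(1) obtain \<sigma>0 x0 y0 where t: "t = lift \<sigma>0 (stack_type [])" and emb0: "embeds \<sigma>0 (start G) x0 A y0"
    and pr0: "productive (stack_type []) x0" "productive (stack_type []) y0" and c_pr: "\<And>D. c = Some D \<Longrightarrow> D \<in> fst t"
    unfolding X_eq by auto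
  have t: "t = stack_type \<sigma>0" using stack_type_append[of \<sigma>0 "[]"] t by simp
  have terminal: "\<exists>w. expands v [] (map Ter w)" if "productive (stack_type []) v" for v
    using productive_expands[of "[]" "({}, {})" v] that by (auto simp: stack_type_def productive_empty_iff)
  obtain p q where pq: "expands x0 [] (map Ter p)" "expands y0 [] (map Ter q)"
    using terminal pr0 by blast
  have start: "p @ u @ q \<in> ilang G" if "expands [NTer A] \<sigma>0 (map Ter u)" for u
  proof -
    have "expands [NTer A] (\<sigma>0 @ []) (map Ter u)" using that by simp
    then have "expands [NTer (start G)] [] (map Ter p @ map Ter u @ map Ter q)"
      using emb0 pq unfolding embeds_def by blast
    then show ?thesis by (simp add: ilang_iff)
  qed
  have closed: "lift [] t = t" using stack_type_append[of "[]" \<sigma>0] t by simp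
  show ?thesis
  proof (cases c)
    case None
    from X(2) obtain \<sigma> x y where "t = lift \<sigma> t" "embeds \<sigma> A x A y" "productive t x" "productive t y"
      "visible t (x @ y)" unfolding X_eq None ctx.simps option.case using \<open>b > 0\<close> by blast
    moreover have "productive t [NTer A]" using runs_None[OF X(4)] X_eq None closed by simp
    ultimately show ?thesis using start t by (intro that[of \<sigma> \<sigma>0 A p q x y "[NTer A]"]) auto
  next
    case (Some D)
    from X(2) obtain \<sigma> x y x' y' where *: "t = lift \<sigma> t" "embeds \<sigma> A x A y" "productive t x"
      "productive t y" "expands [NTer D] \<sigma> (x' @ NTer D # y')" "productive t x'" "productive t y'"
      "visible t (x @ y @ x' @ y')" unfolding X_eq Some ctx.simps option.case using \<open>b > 0\<close> by blast
    from runs_Some[OF X(4)] obtain z z' where z: "embeds [] A z D z'" "productive t z" "productive t z'"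
      unfolding X_eq Some segment_def by blast
    have core: "expands [NTer A] \<rho> u" if "expands (z @ NTer D # z') \<rho> u" for \<rho> u
    proof -
      from that obtain u1 u2 u3 where "u = u1 @ u2 @ u3" "expands z \<rho> u1" "expands [NTer D] \<rho> u2"
        "expands z' \<rho> u3" by (metis expands_append_split expands_Cons_split)
      then show ?thesis using z(1) unfolding embeds_def by (metis append_Nil)
    qed
    have vis: "visible t (x @ y) \<or> (\<exists>D' x' y'. NTer D' \<in> set (z @ NTer D # z') \<and>
      expands [NTer D'] \<sigma> (x' @ NTer D' # y') \<and> productive t (x' @ y') \<and> visible t (x' @ y'))"
    proof (cases "visible t (x @ y)")
      case False
      then show ?thesis using *(5-8) by (intro disjI2 exI[of _ D] exI[of _ x'] exI[of _ y']) simp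
    qed simp
    have "productive t (z @ NTer D # z')" using z c_pr Some by simp
    from that[of \<sigma> \<sigma>0 A p q x y "z @ NTer D # z'", folded t,
        OF *(1)[symmetric] start *(2-4) this core vis]
    show ?thesis .
  qed
qed

text \<open>The equivalence, and not just one implication, makes visibility invariant under the
  morphism built from these choices: empty yields stay empty, as erasing requires.\<close>

lemma choose_expansion:
  assumes "B \<in> fst (lift \<sigma> t)"
  shows "\<exists>v. expands [NTer B] \<sigma> v \<and> productive t v \<and> (visible t v \<longleftrightarrow> B \<in> snd (lift \<sigma> t))"
  using assms by (cases "B \<in> snd (lift \<sigma> t)") (auto simp: lift_def)

lemma infinite_CD0L_subset:
  assumes "infinite (ilang G)"
  shows "\<exists>L'. L' \<subseteq> ilang G \<and> infinite L' \<and> is_CD0L_language L'"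
proof -
  obtain \<sigma>0 \<sigma> A x y p q core where
    cl: "lift \<sigma> (stack_type \<sigma>0) = stack_type \<sigma>0" and
    start: "\<And>u. expands [NTer A] \<sigma>0 (map Ter u) \<Longrightarrow> p @ u @ q \<in> ilang G" and
    emb: "embeds \<sigma> A x A y" and pr: "productive (stack_type \<sigma>0) x" "productive (stack_type \<sigma>0) y" "productive (stack_type \<sigma>0) core" and
    core: "\<And>\<rho> u. expands core \<rho> u \<Longrightarrow> expands [NTer A] \<rho> u" and
    grow: "visible (stack_type \<sigma>0) (x @ y) \<or> (\<exists>D x' y'. NTer D \<in> set core \<and>
      expands [NTer D] \<sigma> (x' @ NTer D # y') \<and> productive (stack_type \<sigma>0) (x' @ y') \<and> visible (stack_type \<sigma>0) (x' @ y'))"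
    by (rule pump_data[OF assms]) blast
  define t where "t = stack_type \<sigma>0"
  note cl = cl[folded t_def] and pr = pr[folded t_def] and grow = grow[folded t_def]
  have "\<exists>v. expands [NTer B] \<sigma> v \<and> productive t v \<and> (visible t v \<longleftrightarrow> B \<in> snd t)" if "B \<in> fst t" for B
    using choose_expansion[of B \<sigma> t] that cl by simp
  then obtain h0 where h0: "\<And>B. B \<in> fst t \<Longrightarrow>
      expands [NTer B] \<sigma> (h0 B) \<and> productive t (h0 B) \<and> (visible t (h0 B) \<longleftrightarrow> B \<in> snd t)" by metis
  \<comment> \<open>\<open>h0\<close> is redefined at \<open>D\<close> alone so that its image is
    the downward loop. Visibility is still right there, since \<open>D\<close> lies in
    \<open>snd (lift \<sigma> t)\<close>.\<close>
  have "\<exists>hN. (\<forall>B \<in> fst t.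
      expands [NTer B] \<sigma> (hN B) \<and> productive t (hN B) \<and> (visible t (hN B) \<longleftrightarrow> B \<in> snd t)) \<and>
    (visible t (x @ y) \<or> (\<exists>D x' y'. NTer D \<in> set core \<and> hN D = x' @ NTer D # y' \<and>
      productive t (x' @ y') \<and> visible t (x' @ y')))"
    using grow
  proof (elim disjE exE conjE)
    fix D x' y' assume D: "NTer D \<in> set core" "expands [NTer D] \<sigma> (x' @ NTer D # y')"
      "productive t (x' @ y')" "visible t (x' @ y')"
    have "D \<in> fst t" using D(1) pr(3) by (simp add: productive_def)
    then have "D \<in> snd (lift \<sigma> t)" using D by (auto simp: lift_def intro!: exI[of _ "x' @ NTer D # y'"])
    then have "D \<in> snd t" using cl by simp
    then show ?thesis using h0 D \<open>D \<in> fst t\<close> by (intro exI[of _ "h0(D := x' @ NTer D # y')"]) auto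
  qed (use h0 in blast)
  then obtain hN where hN: "\<And>B. B \<in> fst t \<Longrightarrow>
      expands [NTer B] \<sigma> (hN B) \<and> productive t (hN B) \<and> (visible t (hN B) \<longleftrightarrow> B \<in> snd t)"
    and grow: "visible t (x @ y) \<or> (\<exists>D x' y'. NTer D \<in> set core \<and> hN D = x' @ NTer D # y' \<and>
      productive t (x' @ y') \<and> visible t (x' @ y'))" by blast
  have "\<exists>w. expands [NTer B] \<sigma>0 (map Ter w) \<and> (w \<noteq> [] \<longleftrightarrow> B \<in> snd t)" if "B \<in> fst t" for B
  proof -
    have "B \<in> fst (lift \<sigma>0 ({}, {}))" using that by (simp add: t_def stack_type_def)
    from choose_expansion[OF this] show ?thesis
      by (auto simp: productive_empty_iff t_def stack_type_def)
  qed
  then obtain gN where gN: "\<And>B. B \<in> fst t \<Longrightarrow>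
      expands [NTer B] \<sigma>0 (map Ter (gN B)) \<and> (gN B \<noteq> [] \<longleftrightarrow> B \<in> snd t)" by metis
  define hs where "hs s = (case s of Ter a \<Rightarrow> [Ter a] | NTer B \<Rightarrow> hN B)" for s :: "('n, 't) gsym"
  define gs where "gs s = (case s of Ter a \<Rightarrow> [a] | NTer B \<Rightarrow> gN B)" for s :: "('n, 't) gsym"
  have hs_simps: "hs (Ter a) = [Ter a]" "hs (NTer B) = hN B" for a B by (simp_all add: hs_def)
  have gs_simps: "gs (Ter a) = [a]" "gs (NTer B) = gN B" for a B by (simp_all add: gs_def)
  let ?h = "morph_ext hs"
  define gv where "gv u = concat (map gs u)" for u
  have gv_append [simp]: "gv (u @ v) = gv u @ gv v" for u v by (simp add: gv_def)
  have hs_step: "expands u \<sigma> (?h u) \<and> productive t (?h u) \<and> (visible t (?h u) \<longleftrightarrow> visible t u)"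
    if "productive t u" for u
    using that
  proof (induction u)
    case (Cons s u)
    have IH: "expands u \<sigma> (?h u)" "productive t (?h u)" "visible t (?h u) \<longleftrightarrow> visible t u"
      using Cons by (cases s; simp)+
    have h_Cons: "?h (s # u) = hs s @ ?h u" by (simp add: morph_ext_def)
    show ?case
    proof (cases s)
      case (Ter a)
      then show ?thesis using IH h_Cons by (auto simp: hs_simps intro: expands.Ter)
    next
      case (NTer B)
      then have "B \<in> fst t" using Cons.prems by simp
      from hN[OF this] show ?thesis using NTer IH h_Cons expands_append[of "[NTer B]" \<sigma> "hN B" u]
        by (auto simp: hs_simps)
    qed
  qed (auto simp: morph_ext_def intro: expands.Nil)
  have gv_step: "expands u \<sigma>0 (map Ter (gv u)) \<and> (gv u \<noteq> [] \<longleftrightarrow> visible t u)"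
    if "productive t u" for u
    using that
  proof (induction u)
    case (Cons s u)
    have IH: "expands u \<sigma>0 (map Ter (gv u))" "gv u \<noteq> [] \<longleftrightarrow> visible t u"
      using Cons by (cases s; simp)+
    have gv_Cons: "gv (s # u) = gs s @ gv u" by (simp add: gv_def)
    show ?case
    proof (cases s)
      case (Ter a)
      then show ?thesis using IH gv_Cons by (auto simp: gs_simps intro: expands.Ter)
    next
      case (NTer B)
      then have "B \<in> fst t" using Cons.prems by simp
      from gN[OF this] show ?thesis
        using NTer IH gv_Cons expands_append[of "[NTer B]" \<sigma>0 "map Ter (gN B)" u] by (auto simp: gs_simps)
    qed
  qed (auto simp: gv_def intro: expands.Nil)
  have iter: "productive t ((?h ^^ n) u) \<and> (visible t ((?h ^^ n) u) \<longleftrightarrow> visible t u)"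
    if "productive t u" for u n
    using that by (induction n) (use hs_step in auto)
  define stack where "stack n = (((@) \<sigma>) ^^ n) \<sigma>0" for n
  have stack_simps: "stack 0 = \<sigma>0" "stack (Suc n) = \<sigma> @ stack n" for n by (auto simp: stack_def)
  have iter_expands: "expands u (stack n) (map Ter (gv ((?h ^^ n) u)))" if "productive t u" for u n
    using that
  proof (induction n arbitrary: u)
    case (Suc n)
    then show ?case
      using expands_trans[of u \<sigma> "?h u" "stack n"] hs_step[of u] by (simp add: stack_simps funpow_swap1)
  qed (use gv_step in \<open>simp add: stack_simps\<close>)

  \<comment> \<open>The markers survive each step; the left one emits \<open>x\<close> to its right
    and the right one \<open>y\<close> to its left. A copy emitted earlier lies further out and is
    iterated more often.\<close>
  define H where "H = case_sum (\<lambda>s. map Inl (hs s))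
    (\<lambda>left. if left then Inr True # map Inl x else map Inl y @ [Inr False])"
  define d where "d = case_sum gs (\<lambda>_::bool. [])"
  let ?H = "morph_ext H"
  define val where "val u = concat (map d u)" for u
  have val_append [simp]: "val (u @ v) = val u @ val v" for u v by (simp add: val_def)
  have val_Inl [simp]: "val (map Inl u) = gv u" for u
    by (simp add: val_def gv_def d_def comp_def)
  have val_Inr [simp]: "val [Inr b] = []" for b by (simp add: val_def d_def)
  have H_Inl [simp]: "?H (map Inl u) = map Inl (?h u)" for u
    by (induction u) (auto simp: morph_ext_def H_def)
  have H_pow_Inl [simp]: "(?H ^^ n) (map Inl u) = map Inl ((?h ^^ n) u)" for n u
    by (induction n) auto
  have H_Inr: "?H [Inr True] = [Inr True] @ map Inl x" "?H [Inr False] = map Inl y @ [Inr False]"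
    by (simp_all add: morph_ext_def H_def)
  define X where "X n = val ((?H ^^ n) [Inr True])" for n
  define Y where "Y n = val ((?H ^^ n) [Inr False])" for n
  have X_simps: "X 0 = []" "X (Suc n) = X n @ gv ((?h ^^ n) x)" for n
    unfolding X_def by (simp_all only: funpow_0 val_Inr funpow_Suc_right comp_def H_Inr
        morph_ext_pow_append val_append val_Inl H_pow_Inl)
  have Y_simps: "Y 0 = []" "Y (Suc n) = gv ((?h ^^ n) y) @ Y n" for n
    unfolding Y_def by (simp_all only: funpow_0 val_Inr funpow_Suc_right comp_def H_Inr
        morph_ext_pow_append val_append val_Inl H_pow_Inl)
  \<comment> \<open>Each use of the upward loop removes one \<sigma>; its side words sit on
    \<open>stack n\<close> and are therefore iterated \<open>n\<close> times.\<close>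
  have unfold_stack: "expands [NTer A] \<sigma>0 (map Ter (X n @ u @ Y n))"
    if "expands [NTer A] (stack n) (map Ter u)" for n u
    using that
  proof (induction n arbitrary: u)
    case (Suc n)
    have "expands [NTer A] (stack n)
      (map Ter (gv ((?h ^^ n) x)) @ map Ter u @ map Ter (gv ((?h ^^ n) y)))"
      using emb Suc.prems iter_expands pr unfolding embeds_def stack_simps by blast
    then show ?case using Suc.IH[of "gv ((?h ^^ n) x) @ u @ gv ((?h ^^ n) y)"]
      by (simp add: X_simps Y_simps)
  qed (simp add: stack_simps X_simps Y_simps)
  define init where
    "init = map Inl (map Ter p) @ [Inr True] @ map Inl core @ [Inr False] @ map Inl (map Ter q)"
  have h_Ter: "(?h ^^ n) (map Ter w) = map Ter w" for n w
    by (induction n) (auto simp: morph_ext_def hs_simps comp_def)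
  have gv_Ter: "gv (map Ter w) = w" for w by (simp add: gv_def gs_simps comp_def)
  have W: "val ((?H ^^ n) init) = p @ (X n @ gv ((?h ^^ n) core) @ Y n) @ q" for n
    unfolding init_def X_def Y_def morph_ext_pow_append val_append H_pow_Inl val_Inl h_Ter gv_Ter by simp
  have in_lang: "val ((?H ^^ n) init) \<in> ilang G" for n
    unfolding W by (rule start[OF unfold_stack[OF core[OF iter_expands[OF pr(3)]]]])
  have long: "length (val ((?H ^^ n) init)) \<ge> n" for n
    using grow
  proof (elim disjE exE conjE)
    assume vis: "visible t (x @ y)"
    have "length (X n) + length (Y n) \<ge> n"
    proof (induction n)
      case (Suc n)
      have "gv ((?h ^^ n) (x @ y)) \<noteq> []"
        using iter[of "x @ y" n] gv_step[of "(?h ^^ n) (x @ y)"] pr vis by simp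
      then have "length (gv ((?h ^^ n) x)) + length (gv ((?h ^^ n) y)) > 0" by auto
      then show ?case using Suc unfolding X_simps Y_simps length_append by linarith
    qed simp
    then show ?thesis unfolding W by simp
  next
    fix D x' y' assume D: "NTer D \<in> set core" "hN D = x' @ NTer D # y'"
      "productive t (x' @ y')" "visible t (x' @ y')"
    have hD: "?h [NTer D] = x' @ [NTer D] @ y'" using D(2) by (simp add: morph_ext_def hs_simps)
    \<comment> \<open>Each step keeps one \<open>D\<close> and adds \<open>x'\<close> and
      \<open>y'\<close>, which together retain a nonempty yield under all iterates.\<close>
    have "length (gv ((?h ^^ n) [NTer D])) \<ge> n"
    proof (induction n)
      case (Suc n)
      have "gv ((?h ^^ n) (x' @ y')) \<noteq> []"
        using iter[of "x' @ y'" n] gv_step[of "(?h ^^ n) (x' @ y')"] D by simp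
      then have "length (gv ((?h ^^ n) x')) + length (gv ((?h ^^ n) y')) > 0" by auto
      moreover have "gv ((?h ^^ Suc n) [NTer D]) =
          gv ((?h ^^ n) x') @ gv ((?h ^^ n) [NTer D]) @ gv ((?h ^^ n) y')"
        by (simp only: funpow_Suc_right comp_def hD morph_ext_pow_append gv_append)
      ultimately show ?case using Suc by (simp only: length_append)
    qed simp
    moreover obtain u v where core_eq: "core = u @ [NTer D] @ v" using D(1) by (auto dest: split_list)
    ultimately show ?thesis
      unfolding W core_eq morph_ext_pow_append gv_append length_append by linarith
  qed

  \<comment> \<open>All terminals that can ever appear, collected so that \<open>Alph\<close> is
    finite and closed under \<open>H\<close>.\<close>
  define Ts where "Ts = set p \<union> set q \<union>
    {a. Ter a \<in> set x \<union> set y \<union> set core \<union> (\<Union>B\<in>fst t. set (hN B))}"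
  have "fst t \<subseteq> nonterms G" unfolding t_def stack_type_def by (rule lift_subset) simp
  then have fin: "finite (fst t)" using wf finite_subset by (auto simp: wf_igrammar_def)
  define Alph where "Alph = Inl ` (Ter ` Ts \<union> NTer ` fst t) \<union> range (Inr :: bool \<Rightarrow> _)"
  have "Ts = set p \<union> set q \<union>
    Ter -` (set x \<union> set y \<union> set core \<union> (\<Union>B\<in>fst t. set (hN B)))" by (auto simp: Ts_def)
  moreover have "finite (Ter -` (set x \<union> set y \<union> set core \<union> (\<Union>B\<in>fst t. set (hN B))))"
    using fin by (intro finite_vimageI) (auto simp: inj_def)
  ultimately have "finite Ts" by simp
  then have finA: "finite Alph" using fin by (simp add: Alph_def)
  have word_A: "set (map Inl u) \<subseteq> Alph" if "productive t u" "{a. Ter a \<in> set u} \<subseteq> Ts" for u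
  proof
    fix z :: "('n, 't) gsym + bool" assume "z \<in> set (map Inl u)"
    then obtain s where "z = Inl s" "s \<in> set u" by auto
    then show "z \<in> Alph" using that by (cases s) (auto simp: Alph_def productive_def)
  qed
  have xyc: "set (map Inl x) \<subseteq> Alph" "set (map Inl y) \<subseteq> Alph" "set (map Inl core) \<subseteq> Alph"
    by (rule word_A; use pr in \<open>auto simp: Ts_def\<close>)+
  have H_A: "set (H a) \<subseteq> Alph" if "a \<in> Alph" for a
  proof -
    from that consider b where "a = Inl (Ter b)" "b \<in> Ts" | B where "a = Inl (NTer B)" "B \<in> fst t"
      | b where "a = Inr b" by (auto simp: Alph_def)
    then show ?thesis
    proof cases
      case 2
      then have "set (map Inl (hN B)) \<subseteq> Alph" using hN by (intro word_A) (auto simp: Ts_def)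
      then show ?thesis using 2 by (simp add: H_def hs_simps)
    next
      case 3
      then show ?thesis using xyc by (auto simp: H_def Alph_def)
    qed (auto simp: H_def hs_simps Alph_def)
  qed
  have init_A: "set init \<subseteq> Alph" using xyc by (auto simp: init_def Alph_def Ts_def)
  \<comment> \<open>Under \<open>d\<close> a marker has empty value although its image may not,
    which would violate \<open>erase\<close>. Decoding one step later repairs this and only omits
    the initial word from the sequence.\<close>
  define d' where "d' a = val (H a)" for a
  have d'_val: "concat (map d' u) = val (?H u)" for u
    by (induction u) (auto simp: d'_def morph_ext_def val_def)
  have erase: "concat (map d' (H a)) = []" if "a \<in> Alph" "d' a = []" for a
  proof -
    have gv_h: "gv (?h u) = []" if "productive t u" "gv u = []" for u
      using that hs_step[of u] gv_step[of u] gv_step[of "?h u"] by blast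
    from that(1) consider b where "a = Inl (Ter b)" | B where "a = Inl (NTer B)" "B \<in> fst t"
      | "a = Inr True" | "a = Inr False" by (auto simp: Alph_def)
    then show ?thesis
    proof cases
      case 1
      then show ?thesis using that(2) by (simp add: d'_def H_def hs_simps gv_def gs_simps val_def d_def)
    next
      case 2
      then have H: "H a = map Inl (hN B)" by (simp add: H_def hs_simps)
      then have "gv (hN B) = []" using that(2) unfolding d'_def H val_Inl by simp
      then show ?thesis unfolding d'_val H H_Inl val_Inl using gv_h[of "hN B"] hN[OF 2(2)] by blast
    next
      case 3
      then have H: "H a = [Inr True] @ map Inl x" by (simp add: H_def)
      then have "gv x = []" using that(2) unfolding d'_def H val_append by simp
      then show ?thesis unfolding d'_val H morph_ext_append H_Inr H_Inl val_append val_Inl val_Inr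
        using gv_h[of x] pr by simp
    next
      case 4
      then have H: "H a = map Inl y @ [Inr False]" by (simp add: H_def)
      then have "gv y = []" using that(2) unfolding d'_def H val_append by simp
      then show ?thesis unfolding d'_val H morph_ext_append H_Inr H_Inl val_append val_Inl val_Inr
        using gv_h[of y] pr by simp
    qed
  qed
  define L' where "L' = {concat (map d' ((?H ^^ i) init)) | i. True}"
  have "is_CD0L_language L'" unfolding L'_def
    using finA H_A init_A erase by (rule CD0L_HD0L)
  moreover have L'_eq: "L' = range (\<lambda>i. val ((?H ^^ Suc i) init))"
    by (auto simp: L'_def d'_val)
  then have "L' \<subseteq> ilang G" using in_lang by blast
  moreover have "infinite L'"
  proof
    assume "finite L'"
    then have "finite (length ` L')" by simp
    then obtain N where N: "\<And>w. w \<in> L' \<Longrightarrow> length w \<le> N"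
      using finite_nat_set_iff_bounded_le by auto
    have "val ((?H ^^ Suc N) init) \<in> L'" unfolding L'_eq by blast
    then show False using N long[of "Suc N"] by fastforce
  qed
  ultimately show ?thesis by blast
qed

end

theorem theorem3:
  fixes L :: "'t list set"
  assumes "is_indexed_language L"
    and "infinite L"
  shows "\<exists>L'. L' \<subseteq> L \<and> infinite L' \<and> is_CD0L_language L'"
proof -
  from assms(1) obtain G :: "(nat, 't, nat) igrammar" where G: "wf_igrammar G" "ilang G = L"
    unfolding is_indexed_language_def by blast
  interpret indexed_grammar G by unfold_locales (fact G(1))
  show ?thesis using infinite_CD0L_subset assms(2) G(2) by simp
qed

end
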